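(* Let $M_f^m(o)$ be an $m$-dimensional model on which the weak Almansi property holds, i.e. there exists a smooth radial function $H=H(r)$ on $M_f^m(o)$ such that: (1) for every open set $U\subset M_f^m(o)$ and every harmonic function $F:U\to\mathbb{R}$, the product $G=H\,F$ is biharmonic on $U$; and (2) for every proper harmonic function $F$ on the whole of $M_f^m(o)$, the product $G=H\,F$ is proper biharmonic on $M_f^m(o)$. Then $M_f^m(o)=\mathbb{R}^m$ (Euclidean space with its canonical metric, the pole $o$ being the origin), and there are real constants $c_1\neq 0$ and $c_2$ such that $$H(x_1,\ldots,x_m)=c_1\sum_{j=1}^m x_j^2+c_2 .$$
   Context: For a smooth Riemannian manifold $(M,g)$, the Laplace-Beltrami operator is $\Delta F=\operatorname{div}(\nabla F)$; $\Delta^0F=F$ and $\Delta^sF=\Delta(\Delta^{s-1}F)$ for integers $s\ge1$. A smooth real-valued function $F$ is $s$-harmonic if $\Delta^sF=0$, and proper $s$-harmonic if moreover $\Delta^{s-1}F$ does not vanish identically. Harmonic means $1$-harmonic (so proper harmonic means harmonic and not identically zero); biharmonic means $2$-harmonic. Models: an $m$-dimensional Riemannian manifold with a pole $o$ is a model if every linear isometry of $T_oM$ is the differential at $o$ of an isometry of $M$. In geodesic polar coordinates centered at $o$ it is described as $$M_f^m(o)=\left(\mathbb{S}^{m-1}\times[0,+\infty),\ f^2(r)\,g_{\mathbb{S}^{m-1}}+dr^2\right),$$ where $\mathbb{S}^{m-1}$ is the Euclidean unit sphere with its standard metric $g_{\mathbb{S}^{m-1}}$ (the locus $r=0$ being collapsed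 to the point $o$), and $f$ is a smooth function with $f(0)=0$, $f'(0)=1$, $f(r)>0$ for $r>0$, and $f^{(2k)}(0)=0$ for all $k\ge1$. One also admits, as models, the case in which $f$ is defined on a finite interval $[0,b]$ (positive on $(0,b)$) with $f(b)=0$, $f'(b)=-1$, $f^{(2k)}(b)=0$ for all $k\ge 1$. The coordinate $r$ is the geodesic distance from $o$; the case $f(r)=r$ is $\mathbb{R}^m$. A radial function is a function depending only on $r$; a $C^\infty$ function $H(r)$, $r\ge0$, is smooth across the pole if and only if $H^{(2k-1)}(0)=0$ for all $k\ge1$. A smooth radial function on $M_f^m(o)$ is required to be smooth across the pole. *)

theory Defs
  imports "HOL-Analysis.Analysis"
begin

text \<open>Calculus on open subsets of \<open>\<real>\<^sup>m\<close>, with \<open>m = CARD('n)\<close>.\<close>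

definition partial :: "'n::finite \<Rightarrow> (real^'n \<Rightarrow> real) \<Rightarrow> real^'n \<Rightarrow> real" where
  "partial i F x = frechet_derivative F (at x) (axis i 1)"

primrec Ck_on :: "nat \<Rightarrow> (real^'n::finite) set \<Rightarrow> (real^'n \<Rightarrow> real) \<Rightarrow> bool" where
  "Ck_on 0 S F \<longleftrightarrow> continuous_on S F"
| "Ck_on (Suc k) S F \<longleftrightarrow>
     (\<forall>x\<in>S. F differentiable (at x)) \<and> (\<forall>i. Ck_on k S (partial i F))"

text \<open>Only meant for open \<open>S\<close>.\<close>

definition smooth_on :: "(real^'n::finite) set \<Rightarrow> (real^'n \<Rightarrow> real) \<Rightarrow> bool" where
  "smooth_on S F \<longleftrightarrow> (\<forall>k. Ck_on k S F)"

text \<open>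
  A Riemannian metric in coordinates is given by its matrix \<open>G x = (g\<^sub>i\<^sub>j(x))\<close>; vector
  fields are given by their components in the coordinate frame.
\<close>

definition gradient ::
    "(real^'n \<Rightarrow> real^'n^'n) \<Rightarrow> (real^'n::finite \<Rightarrow> real) \<Rightarrow> real^'n \<Rightarrow> real^'n" where
  "gradient G F x = matrix_inv (G x) *v (\<chi> i. partial i F x)"

definition divergence ::
    "(real^'n \<Rightarrow> real^'n^'n) \<Rightarrow> (real^'n::finite \<Rightarrow> real^'n) \<Rightarrow> real^'n \<Rightarrow> real" where
  "divergence G X x =
     (\<Sum>i\<in>UNIV. partial i (\<lambda>y. sqrt (det (G y)) * X y $ i) x) / sqrt (det (G x))"

definition laplace_beltrami ::
    "(real^'n \<Rightarrow> real^'n^'n) \<Rightarrow> (real^'n::finite \<Rightarrow> real) \<Rightarrow> real^'n \<Rightarrow> real" where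
  "laplace_beltrami G F = divergence G (gradient G F)"

text \<open>
  Derivatives of a function on an interval \<open>I\<close>, one-sided at the end points belonging
  to \<open>I\<close>.  They only depend on the values of the function on \<open>I\<close>.
\<close>

definition deriv_within :: "real set \<Rightarrow> (real \<Rightarrow> real) \<Rightarrow> real \<Rightarrow> real" where
  "deriv_within I f x = vector_derivative f (at x within I)"

definition smooth_on_interval :: "real set \<Rightarrow> (real \<Rightarrow> real) \<Rightarrow> bool" where
  "smooth_on_interval I f \<longleftrightarrow>
     (\<forall>k. \<forall>x\<in>I. (deriv_within I ^^ k) f differentiable (at x within I))"

text \<open>
  A model is determined by the function \<open>f\<close> and the supremum \<open>b\<close> of the distance to the
  pole: \<open>b = \<infinity>\<close> when \<open>f\<close> is defined on \<open>[0,\<infinity>)\<close>, and \<open>b\<close> is finite when \<open>f\<close> is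
  defined on \<open>[0,b]\<close>.
\<close>

definition radii :: "ereal \<Rightarrow> real set" where
  "radii b = {r. 0 \<le> r \<and> ereal r \<le> b}"

definition model_function :: "(real \<Rightarrow> real) \<Rightarrow> ereal \<Rightarrow> bool" where
  "model_function f b \<longleftrightarrow>
     0 < b \<and> smooth_on_interval (radii b) f \<and>
     (\<forall>r. 0 < r \<and> ereal r < b \<longrightarrow> 0 < f r) \<and>
     f 0 = 0 \<and> deriv_within (radii b) f 0 = 1 \<and>
     (\<forall>k\<ge>1. (deriv_within (radii b) ^^ (2 * k)) f 0 = 0) \<and>
     (\<forall>\<beta>. b = ereal \<beta> \<longrightarrow>
        f \<beta> = 0 \<and> deriv_within (radii b) f \<beta> = - 1 \<and>
        (\<forall>k\<ge>1. (deriv_within (radii b) ^^ (2 * k)) f \<beta> = 0))"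

text \<open>
  A point of the model is represented by its polar coordinates \<open>(\<theta>, r)\<close>.  To collapse the
  spheres \<open>r = 0\<close> and \<open>r = b\<close> to points, \<open>\<theta>\<close> is set to \<open>0\<close> there.
\<close>

type_synonym 'n point = "(real^'n) \<times> real"

definition model_space :: "ereal \<Rightarrow> 'n::finite point set" where
  "model_space b =
     {(\<theta>, r). r \<in> radii b \<and> norm \<theta> = (if r = 0 \<or> ereal r = b then 0 else 1)}"

text \<open>
  Geodesic normal coordinates at the pole and, if \<open>b\<close> is finite, at the antipodal point.
  The two maps below are the inverses of the charts; both have domain \<open>chart_dom b\<close>.
  Note that \<open>sgn 0 = 0\<close>.
\<close>

definition chart_dom :: "ereal \<Rightarrow> (real^'n::finite) set" where
  "chart_dom b = {x. ereal (norm x) < b}"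

definition pole_param :: "real^'n::finite \<Rightarrow> 'n point" where
  "pole_param x = (sgn x, norm x)"

definition antipole_param :: "ereal \<Rightarrow> real^'n::finite \<Rightarrow> 'n point" where
  "antipole_param b x = (sgn x, real_of_ereal b - norm x)"

text \<open>
  The matrix of the metric \<open>f\<^sup>2(r) g\<^sub>S + dr\<^sup>2\<close> in normal coordinates \<open>x\<close>, that is, its
  pull-back under \<open>\<theta> = sgn x\<close>, \<open>r = norm x\<close>, extended smoothly to \<open>x = 0\<close>.  At the antipodal
  point, where \<open>r = b - norm x\<close>, it has the same form with \<open>f (b - t)\<close> in place of \<open>f t\<close>.
\<close>

definition polar_metric :: "(real \<Rightarrow> real) \<Rightarrow> real^'n::finite \<Rightarrow> real^'n^'n" where
  "polar_metric f x =
     (if x = 0 then mat 1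
      else \<chi> i j.
        (f (norm x))\<^sup>2 *
          (frechet_derivative sgn (at x) (axis i 1) \<bullet> frechet_derivative sgn (at x) (axis j 1)) +
        frechet_derivative norm (at x) (axis i 1) * frechet_derivative norm (at x) (axis j 1))"

definition model_open :: "ereal \<Rightarrow> 'n::finite point set \<Rightarrow> bool" where
  "model_open b U \<longleftrightarrow>
     U \<subseteq> model_space b \<and>
     open {x \<in> chart_dom b. pole_param x \<in> U} \<and>
     (b \<noteq> \<infinity> \<longrightarrow> open {x \<in> chart_dom b. antipole_param b x \<in> U})"

definition model_smooth :: "ereal \<Rightarrow> 'n::finite point set \<Rightarrow> ('n point \<Rightarrow> real) \<Rightarrow> bool" where
  "model_smooth b U F \<longleftrightarrow>
     smooth_on {x \<in> chart_dom b. pole_param x \<in> U} (F \<circ> pole_param) \<and>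
     (b \<noteq> \<infinity> \<longrightarrow> smooth_on {x \<in> chart_dom b. antipole_param b x \<in> U} (F \<circ> antipole_param b))"

text \<open>
  The Laplacian is computed in normal coordinates at the pole wherever these are
  available, and at the antipodal point \<open>r = b\<close> in normal coordinates there.
\<close>

definition model_laplacian ::
    "(real \<Rightarrow> real) \<Rightarrow> ereal \<Rightarrow> ('n::finite point \<Rightarrow> real) \<Rightarrow> 'n point \<Rightarrow> real" where
  "model_laplacian f b F = (\<lambda>(\<theta>, r).
     if ereal r < b then laplace_beltrami (polar_metric f) (F \<circ> pole_param) (r *\<^sub>R \<theta>)
     else laplace_beltrami (polar_metric (\<lambda>t. f (real_of_ereal b - t)))
            (F \<circ> antipole_param b) 0)"

definition s_harmonic ::
    "(real \<Rightarrow> real) \<Rightarrow> ereal \<Rightarrow> nat \<Rightarrow> 'n::finite point set \<Rightarrow> ('n point \<Rightarrow> real) \<Rightarrow> bool" where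
  "s_harmonic f b s U F \<longleftrightarrow>
     model_smooth b U F \<and> (\<forall>p\<in>U. (model_laplacian f b ^^ s) F p = 0)"

text \<open>Only meant for \<open>s \<ge> 1\<close>.\<close>

definition proper_s_harmonic ::
    "(real \<Rightarrow> real) \<Rightarrow> ereal \<Rightarrow> nat \<Rightarrow> 'n::finite point set \<Rightarrow> ('n point \<Rightarrow> real) \<Rightarrow> bool" where
  "proper_s_harmonic f b s U F \<longleftrightarrow>
     s_harmonic f b s U F \<and> (\<exists>p\<in>U. (model_laplacian f b ^^ (s - 1)) F p \<noteq> 0)"

definition radial :: "ereal \<Rightarrow> ('n::finite point \<Rightarrow> real) \<Rightarrow> bool" where
  "radial b H \<longleftrightarrow> (\<exists>h. \<forall>p\<in>model_space b. H p = h (snd p))"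

text \<open>The weak Almansi property, with \<open>H\<close> as a witness.\<close>

definition weak_almansi ::
    "(real \<Rightarrow> real) \<Rightarrow> ereal \<Rightarrow> ('n::finite point \<Rightarrow> real) \<Rightarrow> bool" where
  "weak_almansi f b H \<longleftrightarrow>
     model_smooth b (model_space b) H \<and> radial b H \<and>
     (\<forall>U F. model_open b U \<and> s_harmonic f b 1 U F \<longrightarrow>
        s_harmonic f b 2 U (\<lambda>p. H p * F p)) \<and>
     (\<forall>F. proper_s_harmonic f b 1 (model_space b) F \<longrightarrow>
        proper_s_harmonic f b 2 (model_space b) (\<lambda>p. H p * F p))"

text \<open>
  The model is Euclidean space with the pole at the origin: normal coordinates at the pole
  are defined on all of \<open>\<real>\<^sup>m\<close> and the metric is the canonical one.  For \<open>m \<ge> 2\<close> this means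
  \<open>f r = r\<close> for \<open>r \<ge> 0\<close>; for \<open>m = 1\<close> the metric does not involve \<open>f\<close>.
\<close>

definition euclidean_model :: "'n::finite itself \<Rightarrow> (real \<Rightarrow> real) \<Rightarrow> ereal \<Rightarrow> bool" where
  "euclidean_model _ f b \<longleftrightarrow> b = \<infinity> \<and> (\<forall>x::real^'n. polar_metric f x = mat 1)"

end

theory Submission
  imports Defs
begin

text \<open>
  Let \<open>m\<close> be the dimension and \<open>w = f\<^bsup>m-1\<^esup>\<close>, the area density of the geodesic spheres around the pole.
  A radial function with profile \<open>\<phi>\<close> has the radial Laplacian \<open>(w \<phi>')' / w\<close>.  Two radial harmonic
  functions \<open>F\<close> are enough to determine the model and \<open>H\<close>, whose profile is written \<open>g\<close>.

  The first one is \<open>F = 1\<close>, for which the property says that \<open>H\<close> is proper biharmonic on the whole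
  model.  Its Laplacian \<open>u\<close> is harmonic off the pole, so the flux \<open>w u'\<close> is constant; it vanishes
  because \<open>H\<close> is smooth across the pole (\<open>lap'_flux_lim\<close>).  Hence \<open>u\<close> is a constant \<open>c\<close>, and its limit
  at the pole is \<open>m g''(0)\<close> (\<open>lap_constant\<close>).  If \<open>c\<close> were \<open>0\<close>, then \<open>H\<close> would be constant and not
  proper biharmonic (\<open>lap_zero_imp_constant\<close>).  This excludes compact models: there \<open>w g'\<close> vanishes at
  both poles and its derivative \<open>c w\<close> would have a zero in between (\<open>flux_balance\<close>).

  The second one is the radial harmonic function \<open>\<Psi>\<close> off the pole with \<open>\<Psi>' = 1 / w\<close>
  (\<open>radial_harmonic_function\<close>).  A direct computation, in which \<open>w' / w\<close> is eliminated by
  means of \<open>g'' + (w' / w) g' = c\<close>, gives \<open>4 g''' / w\<close> for the bilaplacian of \<open>H \<Psi>\<close>.  So \<open>g''\<close> is a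
  constant \<open>a\<close>, evenness gives \<open>g' = a r\<close> and \<open>g = a r\<^sup>2 / 2 + g 0\<close>, and the equation
  \<open>g'' + (m - 1) (f' / f) g' = m a\<close> turns into \<open>r f' = f\<close> when \<open>m\<close> is at least \<open>2\<close>; since \<open>f'(0) = 1\<close>,
  this means \<open>f r = r\<close> (\<open>third_derivative_zero\<close>).
\<close>

section \<open>Smooth functions of several variables\<close>

lemma partial_eq:
  assumes "(F has_derivative D) (at x)"
  shows "partial i F x = D (axis i 1)"
  using frechet_derivative_at[OF assms] by (simp add: partial_def)

lemma partial_cong:
  assumes "open S" "x \<in> S" "\<And>y. y \<in> S \<Longrightarrow> F y = G y"
  shows "partial i F x = partial i G x"
proof -
  have "(F has_derivative D) (at x) \<longleftrightarrow> (G has_derivative D) (at x)" for D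
    using assms by (metis has_derivative_transform_within_open)
  then show ?thesis
    by (simp add: partial_def frechet_derivative_def)
qed

lemma Ck_on_cong:
  assumes "open S" "\<And>x. x \<in> S \<Longrightarrow> F x = G x"
  shows "Ck_on k S F \<longleftrightarrow> Ck_on k S G"
  using assms(2)
proof (induction k arbitrary: F G)
  case 0
  then show ?case by (simp cong: continuous_on_cong)
next
  case (Suc k)
  have "F differentiable (at x) \<longleftrightarrow> G differentiable (at x)" if "x \<in> S" for x
    using Suc.prems assms(1) that unfolding differentiable_def
    by (metis has_derivative_transform_within_open)
  moreover have "Ck_on k S (partial i F) \<longleftrightarrow> Ck_on k S (partial i G)" for i
    by (rule Suc.IH) (use Suc.prems assms(1) partial_cong in blast)
  ultimately show ?case by simp
qed

text \<open>
  A derivative that is only known on \<open>S\<close> suffices: \<open>S\<close> is open, so the partial derivatives on \<open>S\<close>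
  do not depend on the values elsewhere.
\<close>

lemma Ck_on_SucI:
  assumes "open S" "\<And>x. x \<in> S \<Longrightarrow> (F has_derivative D x) (at x)"
    and "\<And>i. Ck_on k S (\<lambda>x. D x (axis i 1))"
  shows "Ck_on (Suc k) S F"
proof -
  have "Ck_on k S (partial i F)" for i
    using Ck_on_cong[OF assms(1), of "partial i F" "\<lambda>x. D x (axis i 1)"]
      partial_eq[OF assms(2)] assms(3) by blast
  then show ?thesis
    using assms(2) by (auto intro: differentiableI)
qed

lemma Ck_on_Suc_imp:
  assumes "Ck_on (Suc k) S F"
  shows "Ck_on k S F"
  using assms
proof (induction k arbitrary: F)
  case 0
  then show ?case
    by (simp add: differentiable_at_imp_differentiable_on differentiable_imp_continuous_on)
next
  case (Suc k)
  then show ?case by (metis Ck_on.simps(2))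
qed

lemma Ck_on_has_derivative:
  assumes "Ck_on (Suc k) S F" "x \<in> S"
  shows "(F has_derivative frechet_derivative F (at x)) (at x)"
  using assms frechet_derivative_works by auto

lemma Ck_on_partial_frechet:
  assumes "Ck_on (Suc k) S F"
  shows "Ck_on k S (\<lambda>x. frechet_derivative F (at x) (axis i 1))"
  using assms unfolding partial_def[symmetric] by simp

lemma Ck_on_const: "Ck_on k (S :: (real^'n::finite) set) (\<lambda>x. c)"
proof (induction k arbitrary: c)
  case (Suc k)
  have "partial i (\<lambda>x. c) = (\<lambda>x. 0)" for i :: 'n
    by (rule ext) (rule partial_eq[where D = "\<lambda>_. 0", simplified], simp)
  then show ?case by (simp add: Suc)
qed simp

lemma Ck_on_coordinate:
  assumes "open S"
  shows "Ck_on k S (\<lambda>x. x $ j)"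
proof (cases k)
  case (Suc k')
  have "Ck_on (Suc k') S (\<lambda>x. x $ j)"
    by (rule Ck_on_SucI[OF assms, where D = "\<lambda>x v. v $ j"])
      (auto intro!: Ck_on_const bounded_linear_imp_has_derivative bounded_linear_vec_nth)
  with Suc show ?thesis by simp
qed (auto intro: continuous_intros)

lemma Ck_on_add:
  assumes "open S" "Ck_on k S F" "Ck_on k S G"
  shows "Ck_on k S (\<lambda>x. F x + G x)"
  using assms(2,3)
proof (induction k arbitrary: F G)
  case (Suc k)
  show ?case
  proof (rule Ck_on_SucI[OF assms(1)])
    show "((\<lambda>x. F x + G x) has_derivative
        (\<lambda>v. frechet_derivative F (at x) v + frechet_derivative G (at x) v)) (at x)"
      if "x \<in> S" for x
      by (intro has_derivative_add Suc.prems[THEN Ck_on_has_derivative] that)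
  qed (intro Suc.IH Ck_on_partial_frechet Suc.prems)
qed (auto intro: continuous_intros)

lemma Ck_on_mult:
  assumes "open S" "Ck_on k S F" "Ck_on k S G"
  shows "Ck_on k S (\<lambda>x. F x * G x)"
  using assms(2,3)
proof (induction k arbitrary: F G)
  case (Suc k)
  show ?case
  proof (rule Ck_on_SucI[OF assms(1)])
    show "((\<lambda>x. F x * G x) has_derivative
        (\<lambda>v. F x * frechet_derivative G (at x) v + frechet_derivative F (at x) v * G x)) (at x)"
      if "x \<in> S" for x
      by (intro has_derivative_mult Suc.prems[THEN Ck_on_has_derivative] that)
  qed (intro Suc.IH Ck_on_add[OF assms(1)] Ck_on_partial_frechet Ck_on_Suc_imp[of k] Suc.prems)
qed (auto intro: continuous_intros)

lemma Ck_on_power: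
  assumes "open S" "Ck_on k S F"
  shows "Ck_on k S (\<lambda>x. F x ^ n)"
  by (induction n) (auto intro: Ck_on_const Ck_on_mult assms)

lemma Ck_on_inverse:
  assumes "open S" "Ck_on k S F" "\<And>x. x \<in> S \<Longrightarrow> F x \<noteq> 0"
  shows "Ck_on k S (\<lambda>x. inverse (F x))"
  using assms(2)
proof (induction k)
  case (Suc k)
  show ?case
  proof (rule Ck_on_SucI[OF assms(1)])
    show "((\<lambda>x. inverse (F x)) has_derivative
        (\<lambda>v. (-1) * (inverse (F x) * frechet_derivative F (at x) v * inverse (F x)))) (at x)"
      if "x \<in> S" for x
      using Deriv.has_derivative_inverse[OF assms(3)[OF that] Ck_on_has_derivative[OF Suc.prems that]]
      by simp
  qed (intro Suc.IH Ck_on_mult[OF assms(1)] Ck_on_const Ck_on_partial_frechet Ck_on_Suc_imp[of k]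
      Suc.prems)
qed (use assms in \<open>auto intro!: continuous_intros\<close>)

lemma has_derivative_radial:
  fixes x :: "'a::real_inner"
  assumes "x \<noteq> 0" "(\<phi> has_real_derivative d) (at (norm x))"
  shows "((\<lambda>y. \<phi> (norm y)) has_derivative (\<lambda>v. d * (v \<bullet> sgn x))) (at x)"
  using has_derivative_compose[OF has_derivative_norm[OF assms(1)]
      assms(2)[unfolded has_field_derivative_def]] by (simp add: inner_commute)

text \<open>
  Each partial derivative of \<open>\<phi> (norm x)\<close> is \<open>\<phi>' (norm x)\<close> times a coordinate of \<open>x / norm x\<close>,
  so regularity of radial functions off the origin is inherited from the profile once the
  norm itself is known to be smooth there.
\<close>

lemma Ck_on_radialI:
  assumes "open S" "0 \<notin> S" "\<And>x. x \<in> S \<Longrightarrow> (\<phi> has_real_derivative \<phi>' (norm x)) (at (norm x))"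
    and "Ck_on k S (\<lambda>x. \<phi>' (norm x))" "Ck_on k S norm"
  shows "Ck_on (Suc k) S (\<lambda>x. \<phi> (norm x))"
proof (rule Ck_on_SucI[OF assms(1)])
  have nz: "x \<noteq> 0" if "x \<in> S" for x using assms(2) that by auto
  show "((\<lambda>y. \<phi> (norm y)) has_derivative (\<lambda>v. \<phi>' (norm x) * (v \<bullet> sgn x))) (at x)" if "x \<in> S" for x
    using has_derivative_radial[OF nz[OF that] assms(3)[OF that]] .
  have "Ck_on k S (\<lambda>x. \<phi>' (norm x) * (inverse (norm x) * x $ i))" for i
    by (intro Ck_on_mult Ck_on_inverse Ck_on_coordinate assms) (use nz in auto)
  then show "Ck_on k S (\<lambda>x. \<phi>' (norm x) * (axis i 1 \<bullet> sgn x))" for i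
    by (simp add: inner_axis' sgn_div_norm)
qed

lemma Ck_on_norm:
  assumes "open S" "0 \<notin> S"
  shows "Ck_on k S norm"
proof (induction k)
  case (Suc k)
  show ?case
    by (rule Ck_on_radialI[OF assms, where \<phi>' = "\<lambda>_. 1" and \<phi> = "\<lambda>x. x"]) (auto intro: Ck_on_const Suc)
qed (auto intro: continuous_intros)

section \<open>The metric in normal coordinates\<close>

lemma has_derivative_sgn:
  fixes x :: "'a::real_inner"
  assumes "x \<noteq> 0"
  shows "(sgn has_derivative (\<lambda>v. (v - (v \<bullet> sgn x) *\<^sub>R sgn x) /\<^sub>R norm x)) (at x)"
proof -
  have "((\<lambda>y. inverse (norm y)) has_derivative (\<lambda>v. - inverse ((norm x)\<^sup>2) * (v \<bullet> sgn x))) (at x)"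
    by (rule has_derivative_radial[OF assms]) (use assms in \<open>auto intro!: derivative_eq_intros simp: power2_eq_square\<close>)
  then have "((\<lambda>y. y /\<^sub>R norm y) has_derivative
      (\<lambda>v. inverse (norm x) *\<^sub>R v + (- inverse ((norm x)\<^sup>2) * (v \<bullet> sgn x)) *\<^sub>R x)) (at x)"
    by (rule has_derivative_scaleR) simp
  moreover have "(\<lambda>y::'a. y /\<^sub>R norm y) = sgn" by (simp add: sgn_div_norm fun_eq_iff)
  moreover have "inverse (norm x) *\<^sub>R v + (- inverse ((norm x)\<^sup>2) * (v \<bullet> sgn x)) *\<^sub>R x =
      (v - (v \<bullet> sgn x) *\<^sub>R sgn x) /\<^sub>R norm x" for v
    by (simp add: sgn_div_norm power2_eq_square algebra_simps)
  ultimately show ?thesis by (simp only:)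
qed

text \<open>
  The spheres around the pole are scaled by \<open>f r / r\<close> and the radial direction is not scaled:
  off the origin, the metric is \<open>(f r / r)\<^sup>2 (1 - \<theta> \<theta>\<^sup>T) + \<theta> \<theta>\<^sup>T\<close> with \<open>\<theta> = sgn x\<close>.
\<close>

definition stretch :: "real \<Rightarrow> real^'n::finite \<Rightarrow> real^'n^'n" where
  "stretch \<alpha> s = (\<chi> i j. \<alpha> * ((if i = j then 1 else 0) - s $ i * s $ j) + s $ i * s $ j)"

lemma polar_metric_eq_stretch:
  fixes x :: "real^'n::finite"
  assumes "x \<noteq> 0"
  shows "polar_metric f x = stretch ((f (norm x) / norm x)\<^sup>2) (sgn x)"
proof -
  have axis: "axis i (1::real) $ j = (if i = j then 1 else 0)" for i j :: 'n
    by (simp add: axis_def)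
  have s: "sgn x \<bullet> sgn x = 1" using assms by (simp add: dot_square_norm norm_sgn)
  have "frechet_derivative sgn (at x) = (\<lambda>v. (v - (v \<bullet> sgn x) *\<^sub>R sgn x) /\<^sub>R norm x)"
    using frechet_derivative_at[OF has_derivative_sgn[OF assms]] by simp
  moreover have "frechet_derivative norm (at x) = (\<lambda>v. v \<bullet> sgn x)"
    using frechet_derivative_at[OF has_derivative_norm[OF assms]] by simp
  moreover have "((axis i 1 - (axis i 1 \<bullet> sgn x) *\<^sub>R sgn x) /\<^sub>R norm x) \<bullet>
      ((axis j 1 - (axis j 1 \<bullet> sgn x) *\<^sub>R sgn x) /\<^sub>R norm x)
      = ((if i = j then 1 else 0) - sgn x $ i * sgn x $ j) / (norm x)\<^sup>2" for i j
    using assms axis by (simp add: inner_diff_left inner_diff_right inner_axis inner_axis' s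
        power2_eq_square field_simps)
  ultimately show ?thesis
    using assms by (simp add: polar_metric_def stretch_def inner_axis' power_divide)
qed

lemma stretch_one: "stretch 1 s = mat 1"
  by (simp add: stretch_def mat_def vec_eq_iff)

lemma stretch_mult_self:
  assumes "norm s = 1"
  shows "stretch \<alpha> s *v s = s"
proof -
  have s: "(\<Sum>j\<in>UNIV. s $ j * s $ j) = 1"
    using assms by (simp add: norm_eq_1 inner_vec_def)
  have "(\<Sum>j\<in>UNIV. (\<alpha> * ((if i = j then 1 else 0) - s $ i * s $ j) + s $ i * s $ j) * s $ j) = s $ i" for i
  proof -
    have "(\<Sum>j\<in>UNIV. (\<alpha> * ((if i = j then 1 else 0) - s $ i * s $ j) + s $ i * s $ j) * s $ j)
      = (\<Sum>j\<in>UNIV. \<alpha> * (if i = j then s $ j else 0) + ((1 - \<alpha>) * s $ i) * (s $ j * s $ j))"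
      by (rule sum.cong) (auto simp: algebra_simps)
    also have "\<dots> = \<alpha> * s $ i + ((1 - \<alpha>) * s $ i) * (\<Sum>j\<in>UNIV. s $ j * s $ j)"
      by (simp add: sum.distrib flip: sum_distrib_left)
    finally show ?thesis by (simp add: s algebra_simps)
  qed
  then show ?thesis by (simp add: stretch_def matrix_vector_mult_def vec_eq_iff)
qed

text \<open>
  An orthogonal change of basis that takes a basis vector to \<open>s\<close> diagonalizes the matrix, with
  eigenvalue \<open>1\<close> on \<open>s\<close> and \<open>\<alpha>\<close> on its orthogonal complement.
\<close>

lemma det_stretch:
  fixes s :: "real^'n::finite"
  assumes "norm s = 1"
  shows "det (stretch \<alpha> s) = \<alpha> ^ (CARD('n) - 1)"
proof -
  fix k :: 'n
  obtain A where A: "orthogonal_matrix A" "A *v axis k 1 = s"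
    using orthogonal_matrix_exists_basis[OF assms] by metis
  define D :: "real^'n^'n" where "D = (\<chi> i j. if i = j then (if i = k then 1 else \<alpha>) else 0)"
  have Ak: "A $ i $ k = s $ i" for i
    using A(2) by (auto simp: matrix_vector_mul_component inner_axis)
  have "A ** transpose A = mat 1"
    using A(1) by (simp add: orthogonal_matrix_def)
  then have orth: "(\<Sum>l\<in>UNIV. A $ i $ l * A $ j $ l) = (if i = j then 1 else 0)" for i j
    by (simp add: matrix_matrix_mult_def transpose_def mat_def vec_eq_iff)
  have AD: "(A ** D) $ i $ l = A $ i $ l * (if l = k then 1 else \<alpha>)" for i l
    by (simp add: matrix_matrix_mult_def D_def if_distrib[of "\<lambda>z. _ * z"] cong: if_cong)
  have "(A ** D ** transpose A) $ i $ j = stretch \<alpha> s $ i $ j" for i j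
  proof -
    have "(A ** D ** transpose A) $ i $ j
        = (\<Sum>l\<in>UNIV. (A $ i $ l * (if l = k then 1 else \<alpha>)) * A $ j $ l)"
      by (simp add: matrix_matrix_mult_def[of "A ** D"] AD transpose_def)
    also have "\<dots> = (\<Sum>l\<in>UNIV. \<alpha> * (A $ i $ l * A $ j $ l) +
        (if l = k then (1 - \<alpha>) * (A $ i $ l * A $ j $ l) else 0))"
      by (rule sum.cong) (auto simp: algebra_simps)
    also have "\<dots> = \<alpha> * (\<Sum>l\<in>UNIV. A $ i $ l * A $ j $ l) + (1 - \<alpha>) * (s $ i * s $ j)"
      by (simp add: sum.distrib Ak flip: sum_distrib_left)
    finally show ?thesis by (simp add: orth stretch_def algebra_simps)
  qed
  then have "stretch \<alpha> s = A ** D ** transpose A"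
    by (simp add: vec_eq_iff)
  then have "det (stretch \<alpha> s) = det D * (det A * det A)"
    by (simp add: det_mul)
  moreover have "det A * det A = 1"
    using det_orthogonal_matrix[OF A(1)] by auto
  moreover have "det D = (\<Prod>i\<in>UNIV. if i = k then 1 else \<alpha>)"
    using det_diagonal[of D] by (simp add: D_def)
  moreover have "\<dots> = \<alpha> ^ (CARD('n) - 1)"
    by (simp add: prod.If_cases Compl_eq_Diff_UNIV card_Diff_singleton)
  ultimately show ?thesis by simp
qed

lemma polar_metric_euclidean:
  fixes x :: "real^'n::finite"
  assumes "x \<noteq> 0 \<Longrightarrow> CARD('n) \<ge> 2 \<Longrightarrow> f (norm x) = norm x"
  shows "polar_metric f x = mat 1"
proof (cases "x = 0")
  case False
  show ?thesis
  proof (cases "CARD('n) \<ge> 2")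
    case True
    then show ?thesis using False assms polar_metric_eq_stretch[OF False, of f]
      by (simp add: stretch_one)
  next
    \<comment> \<open>In dimension one, the orthogonal complement of \<open>sgn x\<close> is trivial.\<close>
    assume "\<not> CARD('n) \<ge> 2"
    moreover have "CARD('n) > 0" by simp
    ultimately have "CARD('n) = 1" by linarith
    then obtain k :: 'n where k: "UNIV = {k}"
      using card_1_singletonE by blast
    then have eq: "i = k" for i :: 'n by auto
    have "norm (sgn x) = 1" using False by (simp add: norm_sgn)
    then have "sgn x $ k * sgn x $ k = 1"
      by (simp add: norm_eq_1 inner_vec_def k)
    then have "stretch \<alpha> (sgn x) $ i $ j = mat 1 $ i $ j" for \<alpha> i j
      by (simp add: stretch_def mat_def eq[of i] eq[of j])
    then have "stretch \<alpha> (sgn x) = mat 1" for \<alpha>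
      by (simp add: vec_eq_iff)
    then show ?thesis
      using polar_metric_eq_stretch[OF False] by metis
  qed
qed (simp add: polar_metric_def)

lemma open_chart_dom: "open (chart_dom b :: (real^'n::finite) set)"
  by (cases b) (auto simp: chart_dom_def intro!: open_Collect_less continuous_intros)

lemma matrix_inv_eigenvector:
  fixes A :: "real^'n^'n"
  assumes "det A \<noteq> 0" "A *v s = s"
  shows "matrix_inv A *v (c *\<^sub>R s) = c *\<^sub>R s"
proof -
  have "\<exists>B. A ** B = mat 1 \<and> B ** A = mat 1"
    using assms(1) by (simp add: invertible_det_nz flip: invertible_def)
  then have "matrix_inv A ** A = mat 1"
    unfolding matrix_inv_def by (rule someI2_ex) simp
  then have "matrix_inv A *v (A *v (c *\<^sub>R s)) = c *\<^sub>R s"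
    by (simp add: matrix_vector_mul_assoc)
  then show ?thesis by (simp add: matrix_vector_mult_scaleR assms(2))
qed

text \<open>
  The volume density is \<open>(f r / r)\<^bsup>m-1\<^esup>\<close> and the gradient of \<open>\<phi> (norm x)\<close> is \<open>\<phi>' (norm x) sgn x\<close>, so
  the divergence that defines the Laplacian reduces to the derivative of \<open>f\<^bsup>m-1\<^esup> \<phi>'\<close>, the flux
  of the gradient through the spheres around the pole, divided by \<open>f\<^bsup>m-1\<^esup>\<close>.
\<close>

lemma laplace_beltrami_radial:
  fixes \<Phi> :: "real^'n::finite \<Rightarrow> real" and b :: ereal
  defines "m \<equiv> CARD('n)"
  assumes f: "\<And>r. 0 < r \<Longrightarrow> ereal r < b \<Longrightarrow> 0 < f r"
    and \<Phi>: "\<And>y. y \<noteq> 0 \<Longrightarrow> ereal (norm y) < b \<Longrightarrow> \<Phi> y = \<phi> (norm y)"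
    and \<phi>: "\<And>r. 0 < r \<Longrightarrow> ereal r < b \<Longrightarrow> (\<phi> has_real_derivative \<phi>' r) (at r)"
    and q: "((\<lambda>r. f r ^ (m - 1) * \<phi>' r) has_real_derivative q) (at (norm x))"
    and x: "x \<noteq> 0" "ereal (norm x) < b"
  shows "laplace_beltrami (polar_metric f) \<Phi> x = q / f (norm x) ^ (m - 1)"
proof -
  define S :: "(real^'n) set" where "S = chart_dom b - {0}"
  have S: "open S" "x \<in> S" and S_iff: "\<And>y. y \<in> S \<longleftrightarrow> y \<noteq> 0 \<and> ereal (norm y) < b"
    using open_chart_dom[of b] x by (auto simp: S_def chart_dom_def)
  have m: "m = Suc (m - 1)" by (simp add: m_def)
  have dens: "det (polar_metric f y) \<noteq> 0" "sqrt (det (polar_metric f y)) = (f (norm y) / norm y) ^ (m - 1)"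
    and eigen: "polar_metric f y *v sgn y = sgn y" if "y \<in> S" for y
  proof -
    have y: "y \<noteq> 0" "norm (sgn y) = 1" "f (norm y) > 0" using that f by (auto simp: S_iff norm_sgn)
    have det: "det (polar_metric f y) = ((f (norm y) / norm y)\<^sup>2) ^ (m - 1)"
      using y by (simp add: polar_metric_eq_stretch det_stretch m_def)
    show "det (polar_metric f y) \<noteq> 0" using y by (simp add: det)
    show "sqrt (det (polar_metric f y)) = (f (norm y) / norm y) ^ (m - 1)"
      using y by (simp add: det real_sqrt_power)
    show "polar_metric f y *v sgn y = sgn y"
      using y by (simp add: polar_metric_eq_stretch stretch_mult_self)
  qed
  have grad: "gradient (polar_metric f) \<Phi> y = \<phi>' (norm y) *\<^sub>R sgn y" if "y \<in> S" for y
  proof -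
    have "((\<lambda>y. \<phi> (norm y)) has_derivative (\<lambda>v. \<phi>' (norm y) * (v \<bullet> sgn y))) (at y)"
      by (rule has_derivative_radial) (use that \<phi> in \<open>auto simp: S_iff\<close>)
    then have "(\<Phi> has_derivative (\<lambda>v. \<phi>' (norm y) * (v \<bullet> sgn y))) (at y)"
      by (rule has_derivative_transform_within_open[OF _ S(1) that]) (simp add: \<Phi> S_iff)
    then have "(\<chi> i. partial i \<Phi> y) = \<phi>' (norm y) *\<^sub>R sgn y"
      by (simp add: partial_eq inner_axis' vec_eq_iff)
    then show ?thesis
      using matrix_inv_eigenvector[OF dens(1) eigen] that by (simp add: gradient_def)
  qed
  define r where "r = norm x"
  have r: "r > 0" using x by (simp add: r_def)
  define \<psi> where "\<psi> = (\<lambda>r. f r ^ (m - 1) * \<phi>' r / r ^ m)"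
  have flux: "sqrt (det (polar_metric f y)) * gradient (polar_metric f) \<Phi> y $ i = \<psi> (norm y) * y $ i"
    if "y \<in> S" for y i
  proof -
    have "norm y ^ m = norm y * norm y ^ (m - 1)" by (subst m) simp
    then show ?thesis
      using that by (simp add: dens grad \<psi>_def sgn_div_norm power_divide S_iff field_simps)
  qed
  define \<psi>' where "\<psi>' = (q - m * \<psi> r * r ^ (m - 1)) / r ^ m"
  have "(\<psi> has_real_derivative \<psi>') (at r)"
    unfolding \<psi>_def
    by (rule DERIV_cong[OF DERIV_divide[OF q[folded r_def] DERIV_pow]])
      (use r in \<open>auto simp: \<psi>'_def \<psi>_def field_simps\<close>)
  then have "((\<lambda>y. \<psi> (norm y)) has_derivative (\<lambda>v. \<psi>' * (v \<bullet> sgn x))) (at x)"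
    unfolding r_def by (rule has_derivative_radial[OF x(1)])
  moreover have "((\<lambda>y. y $ i) has_derivative (\<lambda>v. v $ i)) (at x)" for i
    by (intro bounded_linear_imp_has_derivative bounded_linear_vec_nth)
  ultimately have D: "((\<lambda>y. \<psi> (norm y) * y $ i) has_derivative
      (\<lambda>v. \<psi> (norm x) * v $ i + \<psi>' * (v \<bullet> sgn x) * x $ i)) (at x)" for i
    by (rule has_derivative_mult)
  have "partial i (\<lambda>y. \<psi> (norm y) * y $ i) x = \<psi> r + \<psi>' * (sgn x $ i * x $ i)" for i
    using partial_eq[OF D, of i i] by (simp add: inner_axis' r_def)
  moreover have "partial i (\<lambda>y. sqrt (det (polar_metric f y)) * gradient (polar_metric f) \<Phi> y $ i) x
      = partial i (\<lambda>y. \<psi> (norm y) * y $ i) x" for i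
    by (rule partial_cong[OF S flux])
  moreover have "(\<Sum>i\<in>UNIV. sgn x $ i * x $ i) = r"
    using x by (simp add: sgn_div_norm flip: inner_vec_def[of "sgn x" x, simplified])
      (simp add: r_def dot_square_norm power2_eq_square)
  ultimately have "laplace_beltrami (polar_metric f) \<Phi> x
      = (m * \<psi> r + \<psi>' * r) / (f r / r) ^ (m - 1)"
    by (simp add: laplace_beltrami_def divergence_def dens S sum.distrib m_def r_def
        flip: sum_distrib_left)
  moreover have "m * \<psi> r + \<psi>' * r = q / r ^ (m - 1)"
  proof -
    have "r ^ m = r * r ^ (m - 1)" by (subst m) simp
    then show ?thesis using r by (simp add: \<psi>'_def field_simps)
  qed
  ultimately show ?thesis using r by (simp add: power_divide r_def)
qed

section \<open>Radial functions on the model\<close>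

lemma norm_scaleR_sgn: "norm x *\<^sub>R sgn x = (x :: 'a::real_normed_vector)"
  by (cases "x = 0") (simp_all add: sgn_div_norm)

lemma radial_model_laplacian:
  fixes F :: "'n::finite point \<Rightarrow> real"
  assumes "\<And>r. 0 < r \<Longrightarrow> ereal r < b \<Longrightarrow> 0 < f r"
    and "\<And>y. y \<noteq> 0 \<Longrightarrow> ereal (norm y) < b \<Longrightarrow> F (pole_param y) = \<phi> (norm y)"
    and "\<And>r. 0 < r \<Longrightarrow> ereal r < b \<Longrightarrow> (\<phi> has_real_derivative \<phi>' r) (at r)"
    and "((\<lambda>r. f r ^ (CARD('n) - 1) * \<phi>' r) has_real_derivative q) (at (norm x))"
    and "x \<noteq> 0" "ereal (norm x) < b"
  shows "model_laplacian f b F (pole_param x) = q / f (norm x) ^ (CARD('n) - 1)"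
  using laplace_beltrami_radial[of b f "F \<circ> pole_param" \<phi> \<phi>' q x] assms
  by (simp add: model_laplacian_def pole_param_def norm_scaleR_sgn)

lemma Ck_on_partial_iterate:
  assumes "smooth_on S F"
  shows "Ck_on k S ((partial i ^^ j) F)"
  using assms unfolding smooth_on_def
proof (induction j arbitrary: k)
  case (Suc j)
  from Suc.IH[of "Suc k"] Suc.prems show ?case by simp
qed simp

lemma line_derivative:
  fixes F :: "real^'n::finite \<Rightarrow> real"
  assumes "smooth_on S F" "t *\<^sub>R axis i 1 \<in> S"
  shows "((\<lambda>t. (partial i ^^ j) F (t *\<^sub>R axis i 1)) has_real_derivative
    (partial i ^^ Suc j) F (t *\<^sub>R axis i 1)) (at t)"
proof -
  let ?G = "(partial i ^^ j) F" and ?e = "axis i 1 :: real^'n"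
  have D: "(?G has_derivative frechet_derivative ?G (at (t *\<^sub>R ?e))) (at (t *\<^sub>R ?e))"
    using Ck_on_has_derivative[OF Ck_on_partial_iterate[OF assms(1)] assms(2)] .
  have "((\<lambda>t. ?G (t *\<^sub>R ?e)) has_derivative
      (\<lambda>h. frechet_derivative ?G (at (t *\<^sub>R ?e)) (h *\<^sub>R ?e))) (at t)"
    by (rule has_derivative_compose[where f = "\<lambda>t. t *\<^sub>R ?e", OF _ D]) (auto intro!: derivative_eq_intros)
  moreover have "frechet_derivative ?G (at (t *\<^sub>R ?e)) (h *\<^sub>R ?e)
      = h * partial i ?G (t *\<^sub>R ?e)" for h
    using linear_cmul[OF has_derivative_linear[OF D]] by (simp add: partial_def)
  ultimately show ?thesis
    by (simp add: has_field_derivative_def mult_commute_abs)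
qed

text \<open>
  Restricting a smooth rotationally symmetric function to a line through the origin gives an even
  profile, so its derivatives of odd order vanish at the origin.
\<close>

lemma radial_profile:
  fixes \<Phi> :: "real^'n::finite \<Rightarrow> real"
  assumes smooth: "smooth_on (chart_dom b) \<Phi>"
    and radial: "\<And>x y. x \<in> chart_dom b \<Longrightarrow> norm x = norm y \<Longrightarrow> \<Phi> x = \<Phi> y"
  obtains g :: "nat \<Rightarrow> real \<Rightarrow> real"
  where "\<And>j t. ereal \<bar>t\<bar> < b \<Longrightarrow> (g j has_real_derivative g (Suc j) t) (at t)"
    and "\<And>x. x \<in> chart_dom b \<Longrightarrow> \<Phi> x = g 0 (norm x)"
    and "\<And>j. 0 < b \<Longrightarrow> odd j \<Longrightarrow> g j 0 = 0"
proof
  fix i :: 'n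
  define g where "g j t = (partial i ^^ j) \<Phi> (t *\<^sub>R axis i 1)" for j t
  have dom: "t *\<^sub>R (axis i 1 :: real^'n) \<in> chart_dom b \<longleftrightarrow> ereal \<bar>t\<bar> < b" for t
    by (simp add: chart_dom_def)
  show D: "(g j has_real_derivative g (Suc j) t) (at t)" if "ereal \<bar>t\<bar> < b" for j t
    using line_derivative[OF smooth, of t i j] that unfolding g_def dom .
  show "\<Phi> x = g 0 (norm x)" if "x \<in> chart_dom b" for x
    using radial[OF that, of "norm x *\<^sub>R axis i 1"] by (simp add: g_def)
  have "open {t. ereal \<bar>t\<bar> < b}"
    by (cases b) (auto intro!: open_Collect_less continuous_intros)
  have parity: "g j (- t) = (- 1) ^ j * g j t" if "ereal \<bar>t\<bar> < b" for j t
    using that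
  proof (induction j arbitrary: t)
    case 0
    then show ?case using radial[of "t *\<^sub>R axis i 1" "- t *\<^sub>R axis i 1"] by (simp add: g_def dom)
  next
    case (Suc j)
    have "((\<lambda>t. g j (- t)) has_real_derivative - g (Suc j) (- t)) (at t)"
      using DERIV_chain2[OF D[of "- t" j] DERIV_minus[OF DERIV_ident]] Suc.prems by simp
    then have "((\<lambda>t. (- 1) ^ j * g j t) has_real_derivative - g (Suc j) (- t)) (at t)"
      by (rule has_field_derivative_transform_within_open[OF _ \<open>open {t. ereal \<bar>t\<bar> < b}\<close>])
        (use Suc in auto)
    moreover have "((\<lambda>t. (- 1) ^ j * g j t) has_real_derivative (- 1) ^ j * g (Suc j) t) (at t)"
      by (rule DERIV_cmult[OF D[OF Suc.prems]])
    ultimately have "- g (Suc j) (- t) = (- 1) ^ j * g (Suc j) t"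
      by (rule DERIV_unique)
    then show ?case by simp
  qed
  show "g j 0 = 0" if "0 < b" "odd j" for j
    using parity[of 0 j] that by (simp add: zero_ereal_def)
qed

section \<open>The radial Laplacian as a differential operator on profiles\<close>

text \<open>
  The differential equations are singular at the pole, so constants of integration are determined
  by one-sided limits there.
\<close>

lemma zero_derivative_limit:
  fixes P :: "real \<Rightarrow> real"
  assumes "\<And>r. 0 < r \<Longrightarrow> ereal r < b \<Longrightarrow> (P has_real_derivative 0) (at r)"
    and "(P \<longlongrightarrow> l) (at_right 0)" "0 < r" "ereal r < b"
  shows "P r = l"
proof -
  have eq: "P s = P r" if "0 < s" "s < r" for s
  proof -
    have "ereal z < b" if "z \<le> r" for z
      using that assms(4) by (metis ereal_less_eq(3) le_less_trans)
    then have "\<exists>z. s < z \<and> z < r \<and> P r - P s = (r - s) * 0"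
      using that by (intro MVT2 assms(1)) auto
    then show ?thesis by auto
  qed
  have "eventually (\<lambda>s. P s = P r) (at_right 0)"
    using assms(3) eq by (auto simp: eventually_at_right_field)
  then have "((\<lambda>s. P r) \<longlongrightarrow> l) (at_right (0::real))"
    by (rule Lim_transform_eventually[OF assms(2)])
  then show ?thesis
    using tendsto_unique[OF trivial_limit_at_right_real tendsto_const] by blast
qed

text \<open>
  Here \<open>f j\<close> and \<open>g j\<close> are the \<open>j\<close>-th derivatives of the function of the model and of the profile
  of a smooth radial function, and \<open>n + 1\<close> is the dimension.
\<close>

locale radial_profiles =
  fixes f g :: "nat \<Rightarrow> real \<Rightarrow> real" and b :: ereal and n :: nat
  assumes b_pos: "0 < b"
    and f_pos: "0 < r \<Longrightarrow> ereal r < b \<Longrightarrow> 0 < f 0 r"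
    and f_deriv: "0 < r \<Longrightarrow> ereal r < b \<Longrightarrow> (f j has_real_derivative f (Suc j) r) (at r)"
    and f_lim: "(f j \<longlongrightarrow> f j 0) (at_right 0)"
    and f_0: "f 0 0 = 0" and f_1: "f 1 0 = 1"
    and f_slope: "((\<lambda>r. f 0 r / r) \<longlongrightarrow> 1) (at_right 0)"
    and g_deriv: "ereal \<bar>t\<bar> < b \<Longrightarrow> (g j has_real_derivative g (Suc j) t) (at t)"
    and g_odd: "odd j \<Longrightarrow> g j 0 = 0"
begin

lemma inside: "0 < r \<Longrightarrow> ereal r < b \<Longrightarrow> ereal \<bar>r\<bar> < b"
  by simp

lemma eventually_inside: "eventually (\<lambda>r. 0 < r \<and> ereal r < b) (at_right 0)"
proof -
  obtain e where e: "0 < e" "ereal e < b"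
    using b_pos ereal_dense2[of 0 b] by auto
  then have "ereal r < b" if "r < e" for r
    using that by (metis ereal_less_eq(3) le_less_trans less_imp_le)
  then show ?thesis
    using e by (auto simp: eventually_at_right_field)
qed

lemma g_lim: "(g j \<longlongrightarrow> g j 0) (at_right 0)"
proof -
  have "isCont (g j) 0"
    using g_deriv[of 0 j] b_pos DERIV_isCont by (simp add: zero_ereal_def)
  then show ?thesis
    by (auto simp: isCont_def intro: filterlim_mono[OF _ order_refl at_le])
qed

lemma g1_slope: "((\<lambda>r. g 1 r / f 0 r) \<longlongrightarrow> g 2 0) (at_right 0)"
proof -
  have "((\<lambda>r. g 1 r / r) \<longlongrightarrow> g 2 0) (at 0)"
    using g_deriv[of 0 1] b_pos g_odd[of 1]
    by (simp add: zero_ereal_def has_field_derivative_iff numeral_2_eq_2)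
  then have "((\<lambda>r. g 1 r / r) \<longlongrightarrow> g 2 0) (at_right 0)"
    by (auto intro: filterlim_mono[OF _ order_refl at_le])
  from tendsto_divide[OF this f_slope]
  have "((\<lambda>r. (g 1 r / r) / (f 0 r / r)) \<longlongrightarrow> g 2 0) (at_right 0)"
    by simp
  then show ?thesis
    by (rule Lim_transform_eventually) (use eventually_inside in eventually_elim, simp)
qed

text \<open>
  The area density of the spheres around the pole, and then the Laplacian of the radial function
  with profile \<open>g 0\<close> together with its radial derivative.
\<close>

definition w :: "real \<Rightarrow> real" where "w r = f 0 r ^ n"

lemma w_pos: "0 < r \<Longrightarrow> ereal r < b \<Longrightarrow> 0 < w r"
  using f_pos by (simp add: w_def)

lemma w_deriv:
  assumes "0 < r" "ereal r < b"
  shows "(w has_real_derivative n * (f 1 r / f 0 r) * w r) (at r)"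
proof (cases n)
  case 0
  then show ?thesis unfolding w_def by simp
next
  case (Suc k)
  show ?thesis
    unfolding w_def
    by (rule DERIV_cong[OF DERIV_power[OF f_deriv[OF assms]]])
      (use Suc f_pos[OF assms] in \<open>simp add: field_simps\<close>)
qed

definition lap :: "real \<Rightarrow> real" where
  "lap r = g 2 r + n * (f 1 r / f 0 r) * g 1 r"

definition lap' :: "real \<Rightarrow> real" where
  "lap' r = g 3 r + n * ((f 2 r * f 0 r - (f 1 r)\<^sup>2) / (f 0 r)\<^sup>2 * g 1 r + f 1 r / f 0 r * g 2 r)"

lemma flux_deriv:
  assumes "0 < r" "ereal r < b"
  shows "((\<lambda>r. w r * g 1 r) has_real_derivative w r * lap r) (at r)"
  by (rule DERIV_cong[OF DERIV_mult[OF w_deriv[OF assms] g_deriv[OF inside[OF assms]]]])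
    (simp add: lap_def algebra_simps numeral_2_eq_2)

lemma lap_deriv:
  assumes "0 < r" "ereal r < b"
  shows "(lap has_real_derivative lap' r) (at r)"
proof -
  note D = g_deriv[OF inside[OF assms]] f_deriv[OF assms]
  have g: "(g 1 has_real_derivative g 2 r) (at r)" "(g 2 has_real_derivative g 3 r) (at r)"
    and f: "(f 0 has_real_derivative f 1 r) (at r)" "(f 1 has_real_derivative f 2 r) (at r)"
    using D(1)[of 1] D(1)[of 2] D(2)[of 0] D(2)[of 1] by (simp_all add: numeral_2_eq_2 numeral_3_eq_3)
  show ?thesis
    unfolding lap_def
    by (rule DERIV_cong[OF DERIV_add[OF g(2) DERIV_mult[OF DERIV_cmult[OF
              DERIV_divide[OF f(2,1)]] g(1)]]])
      (use f_pos[OF assms] in \<open>auto simp: lap'_def power2_eq_square algebra_simps\<close>)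
qed

lemma lap'_differentiable:
  assumes "0 < r" "ereal r < b"
  obtains d where "((\<lambda>r. w r * lap' r) has_real_derivative d) (at r)"
proof -
  have "g j differentiable (at r)" "f j differentiable (at r)" for j
    using g_deriv[OF inside[OF assms]] f_deriv[OF assms] real_differentiable_def by blast+
  then have "(\<lambda>r. w r * lap' r) differentiable (at r)"
    unfolding lap'_def w_def using f_pos[OF assms]
    by (intro derivative_intros) auto
  then show thesis using that real_differentiable_def by blast
qed

text \<open>
  The singular terms of \<open>lap'\<close> at the pole are \<open>n / f\<close> times \<open>(f f'' - f'\<^sup>2) (g' / f) + f' g''\<close>, and
  there they cancel: \<open>g' / f\<close> tends to \<open>g'' 0\<close>, \<open>f\<close> to \<open>0\<close> and \<open>f'\<close> to \<open>1\<close>.  For \<open>n = 0\<close>, the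
  limit is zero because the third derivative of an even function vanishes at \<open>0\<close>.
\<close>

lemma lap'_flux_lim: "((\<lambda>r. w r * lap' r) \<longlongrightarrow> 0) (at_right 0)"
proof -
  have "((\<lambda>r. f 0 r ^ n * g 3 r + n * f 0 r ^ (n - 1) *
      ((f 2 r * f 0 r - (f 1 r)\<^sup>2) * (g 1 r / f 0 r) + f 1 r * g 2 r)) \<longlongrightarrow>
      f 0 0 ^ n * g 3 0 + n * f 0 0 ^ (n - 1) *
      ((f 2 0 * f 0 0 - (f 1 0)\<^sup>2) * g 2 0 + f 1 0 * g 2 0)) (at_right 0)"
    by (intro tendsto_intros f_lim g_lim g1_slope)
  then have "((\<lambda>r. f 0 r ^ n * g 3 r + n * f 0 r ^ (n - 1) *
      ((f 2 r * f 0 r - (f 1 r)\<^sup>2) * (g 1 r / f 0 r) + f 1 r * g 2 r)) \<longlongrightarrow> 0) (at_right 0)"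
    using g_odd[of 3] by (simp add: f_0 f_1[simplified])
  then show ?thesis
  proof (rule Lim_transform_eventually, use eventually_inside in eventually_elim)
    case (elim r)
    then have nz: "f 0 r \<noteq> 0" using f_pos by fastforce
    then have power: "n * f 0 r ^ (n - 1) = n * w r / f 0 r"
      using w_def[of r] by (cases n) auto
    show ?case
      unfolding power lap'_def w_def[symmetric] using nz
      by (simp add: field_simps power2_eq_square)
  qed
qed

lemma lap_lim: "(lap \<longlongrightarrow> (n + 1) * g 2 0) (at_right 0)"
proof -
  have "((\<lambda>r. g 2 r + n * (f 1 r * (g 1 r / f 0 r))) \<longlongrightarrow> g 2 0 + n * (f 1 0 * g 2 0)) (at_right 0)"
    by (intro tendsto_intros f_lim g_lim g1_slope)
  then show ?thesis by (simp add: lap_def[abs_def] f_1[simplified] algebra_simps)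
qed

text \<open>
  A radial function which is harmonic off the pole has constant flux \<open>w u'\<close>; regularity at the pole
  makes the flux vanish, so the function is constant.
\<close>

lemma lap_constant:
  assumes "\<And>r d. 0 < r \<Longrightarrow> ereal r < b \<Longrightarrow>
      ((\<lambda>r. w r * lap' r) has_real_derivative d) (at r) \<Longrightarrow> d = 0"
    and "0 < r" "ereal r < b"
  shows "lap r = (n + 1) * g 2 0"
proof (rule zero_derivative_limit[OF _ lap_lim assms(2,3)])
  fix r assume r: "0 < r" "ereal r < b"
  have "w r * lap' r = 0"
  proof (rule zero_derivative_limit[OF _ lap'_flux_lim r])
    fix s assume "0 < s" "ereal s < b"
    then show "((\<lambda>r. w r * lap' r) has_real_derivative 0) (at s)"
      using lap'_differentiable assms(1) by metis
  qed
  then show "(lap has_real_derivative 0) (at r)"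
    using lap_deriv[OF r] w_pos[OF r] by auto
qed

lemma flux_lim: "((\<lambda>r. w r * g 1 r) \<longlongrightarrow> 0) (at_right 0)"
proof -
  have "((\<lambda>r. w r * g 1 r) \<longlongrightarrow> f 0 0 ^ n * g 1 0) (at_right 0)"
    unfolding w_def by (intro tendsto_intros f_lim g_lim)
  then show ?thesis by (simp add: g_odd)
qed

lemma lap_zero_imp_constant:
  assumes "\<And>r. 0 < r \<Longrightarrow> ereal r < b \<Longrightarrow> lap r = 0" "0 < r" "ereal r < b"
  shows "g 0 r = g 0 0"
proof (rule zero_derivative_limit[OF _ g_lim assms(2,3)])
  fix r assume r: "0 < r" "ereal r < b"
  have "w r * g 1 r = 0"
    by (rule zero_derivative_limit[OF _ flux_lim r]) (use flux_deriv assms(1) in fastforce)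
  then show "(g 0 has_real_derivative 0) (at r)"
    using w_pos[OF r] g_deriv[OF inside[OF r], of 0] by simp
qed

lemma w_inverse_deriv:
  assumes "0 < r" "ereal r < b"
  shows "((\<lambda>r. 1 / w r) has_real_derivative - (n * (f 1 r / f 0 r) / w r)) (at r)"
  by (rule DERIV_cong[OF DERIV_divide[OF DERIV_const w_deriv[OF assms]]])
    (use w_pos[OF assms] f_pos[OF assms] in \<open>auto simp: field_simps\<close>)

text \<open>
  In terms of \<open>G = g \<Psi>\<close> with \<open>\<Psi>' = 1 / w\<close>: the flux of \<open>G\<close> is \<open>w g' \<Psi> + g\<close>, so its Laplacian is
  \<open>c \<Psi> + 2 g' / w\<close>; the flux of the latter is \<open>4 g'' - c\<close>, because \<open>g'\<close> times the logarithmic derivative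
  of \<open>w\<close> is \<open>c - g''\<close>.
\<close>

context
  fixes \<Psi> :: "real \<Rightarrow> real" and c :: real
  assumes \<Psi>: "\<And>r. 0 < r \<Longrightarrow> ereal r < b \<Longrightarrow> (\<Psi> has_real_derivative 1 / w r) (at r)"
    and lap_c: "\<And>r. 0 < r \<Longrightarrow> ereal r < b \<Longrightarrow> lap r = c"
begin

lemma product_deriv:
  assumes "0 < r" "ereal r < b"
  shows "((\<lambda>r. g 0 r * \<Psi> r) has_real_derivative (w r * g 1 r * \<Psi> r + g 0 r) / w r) (at r)"
  by (rule DERIV_cong[OF DERIV_mult[OF g_deriv[OF inside[OF assms]] \<Psi>[OF assms]]])
    (use w_pos[OF assms] in \<open>simp add: field_simps\<close>)

lemma product_flux_deriv:
  assumes "0 < r" "ereal r < b"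
  shows "((\<lambda>r. w r * g 1 r * \<Psi> r + g 0 r) has_real_derivative
    (c * \<Psi> r + 2 * (g 1 r * (1 / w r))) * w r) (at r)"
  by (rule DERIV_cong[OF DERIV_add[OF DERIV_mult[OF flux_deriv[OF assms] \<Psi>[OF assms]]
        g_deriv[OF inside[OF assms]]]])
    (use w_pos[OF assms] lap_c[OF assms] in \<open>simp add: field_simps\<close>)

lemma product_lap_deriv:
  assumes "0 < r" "ereal r < b"
  shows "((\<lambda>r. c * \<Psi> r + 2 * (g 1 r * (1 / w r))) has_real_derivative (4 * g 2 r - c) / w r) (at r)"
proof -
  define k where "k = n * (f 1 r / f 0 r)"
  have "c = g 2 r + k * g 1 r"
    using lap_c[OF assms] by (simp add: lap_def k_def)
  then have eq: "c * (1 / w r) + 2 * (g 2 r * (1 / w r) + - (k / w r) * g 1 r) = (4 * g 2 r - c) / w r"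
    using w_pos[OF assms] by (simp add: field_simps)
  have "(g 1 has_real_derivative g 2 r) (at r)"
    using g_deriv[OF inside[OF assms], of 1] by (simp add: numeral_2_eq_2)
  from DERIV_add[OF DERIV_cmult[OF \<Psi>[OF assms]]
      DERIV_cmult[OF DERIV_mult[OF this w_inverse_deriv[OF assms, folded k_def]]]]
  show ?thesis by (rule DERIV_cong) (rule eq)
qed

end

text \<open>
  Here \<open>g''\<close> is a constant \<open>a\<close> and \<open>g' = a r\<close>.  For \<open>a\<close> and \<open>n\<close> different from \<open>0\<close>, the equation
  \<open>g'' + n (f' / f) g' = (n + 1) a\<close> becomes \<open>r f' = f\<close>, so the model is flat.
\<close>

lemma third_derivative_zero:
  assumes g3: "\<And>r. 0 < r \<Longrightarrow> ereal r < b \<Longrightarrow> g 3 r = 0"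
    and lap: "\<And>r. 0 < r \<Longrightarrow> ereal r < b \<Longrightarrow> lap r = (n + 1) * g 2 0"
    and r: "0 < r" "ereal r < b"
  shows "g 0 r = g 2 0 / 2 * r\<^sup>2 + g 0 0" and "g 2 0 \<noteq> 0 \<Longrightarrow> n \<noteq> 0 \<Longrightarrow> f 0 r = r"
proof -
  define a where "a = g 2 0"
  have id0: "((\<lambda>r::real. r) \<longlongrightarrow> 0) (at_right 0)"
    by (rule tendsto_ident_at)
  have g2: "g 2 r = a" if "0 < r" "ereal r < b" for r
    unfolding a_def
  proof (rule zero_derivative_limit[OF _ g_lim that])
    show "(g 2 has_real_derivative 0) (at r)" if "0 < r" "ereal r < b" for r
      using g_deriv[OF inside[OF that], of 2] g3[OF that] by (simp add: numeral_2_eq_2 numeral_3_eq_3)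
  qed
  have g1: "g 1 r = a * r" if "0 < r" "ereal r < b" for r
  proof -
    have "g 1 r - a * r = 0"
    proof (rule zero_derivative_limit[OF _ _ that])
      show "((\<lambda>r. g 1 r - a * r) has_real_derivative 0) (at r)" if "0 < r" "ereal r < b" for r
        by (rule DERIV_cong[OF DERIV_diff[OF g_deriv[OF inside[OF that]] DERIV_cmult[OF DERIV_ident]]])
          (use g2[OF that] in \<open>simp add: numeral_2_eq_2\<close>)
      show "((\<lambda>r. g 1 r - a * r) \<longlongrightarrow> 0) (at_right 0)"
        using tendsto_diff[OF g_lim[of 1] tendsto_mult[OF tendsto_const[of a] id0]] by (simp add: g_odd)
    qed
    then show ?thesis by simp
  qed
  have "g 0 r - a / 2 * r\<^sup>2 = g 0 0"
  proof (rule zero_derivative_limit[OF _ _ r])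
    show "((\<lambda>r. g 0 r - a / 2 * r\<^sup>2) has_real_derivative 0) (at r)" if "0 < r" "ereal r < b" for r
      by (rule DERIV_cong[OF DERIV_diff[OF g_deriv[OF inside[OF that]] DERIV_cmult[OF DERIV_pow]]])
        (use g1[OF that] in simp)
    show "((\<lambda>r. g 0 r - a / 2 * r\<^sup>2) \<longlongrightarrow> g 0 0) (at_right 0)"
      using tendsto_diff[OF g_lim[of 0] tendsto_mult[OF tendsto_const[of "a / 2"] tendsto_power[OF id0, of 2]]] by simp
  qed
  then show "g 0 r = g 2 0 / 2 * r\<^sup>2 + g 0 0" by (simp add: a_def)
  assume "g 2 0 \<noteq> 0" "n \<noteq> 0"
  then have a: "a \<noteq> 0" by (simp add: a_def)
  have "f 0 r / r = 1"
  proof (rule zero_derivative_limit[OF _ f_slope r])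
    fix r assume r: "0 < r" "ereal r < b"
    have "a + n * (f 1 r / f 0 r) * (a * r) = (n + 1) * a"
      using lap[OF r] unfolding lap_def g1[OF r] g2[OF r] a_def[symmetric] .
    then have "(n * a) * (f 1 r / f 0 r * r) = (n * a) * 1"
      by (simp add: algebra_simps)
    then have "f 1 r / f 0 r * r = 1"
      using a \<open>n \<noteq> 0\<close> by (metis mult_cancel_left mult_eq_0_iff of_nat_eq_0_iff)
    then have "f 1 r * r = f 0 r"
      using f_pos[OF r] by (simp add: field_simps)
    then show "((\<lambda>r. f 0 r / r) has_real_derivative 0) (at r)"
      by (intro DERIV_cong[OF DERIV_divide[OF f_deriv[OF r] DERIV_ident]]) (use r in auto)
  qed
  then show "f 0 r = r" using r by (simp add: field_simps)
qed

end

section \<open>The functions of a model\<close>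

lemma pole_param_mem:
  fixes x :: "real^'n::finite"
  assumes "x \<in> chart_dom b"
  shows "pole_param x \<in> model_space b"
  using assms by (auto simp: pole_param_def model_space_def chart_dom_def radii_def norm_sgn)

lemma antipole_param_mem:
  fixes x :: "real^'n::finite"
  assumes "b = ereal \<beta>" "0 < \<beta>" "x \<in> chart_dom b"
  shows "antipole_param b x \<in> model_space b"
  using assms by (auto simp: antipole_param_def model_space_def chart_dom_def radii_def norm_sgn)

lemma model_space_cases:
  fixes p :: "'n::finite point"
  assumes "p \<in> model_space b"
  obtains x where "x \<in> chart_dom b" "p = pole_param x"
  | \<beta> where "b = ereal \<beta>" "p = antipole_param b 0"
proof -
  obtain \<theta> r where p: "p = (\<theta>, r)" by fastforce
  have r: "0 \<le> r" "ereal r \<le> b" and \<theta>: "norm \<theta> = (if r = 0 \<or> ereal r = b then 0 else 1)"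
    using assms by (auto simp: p model_space_def radii_def)
  show thesis
  proof (cases "ereal r = b")
    case True
    then show thesis using that(2)[of r] \<theta> by (auto simp: p antipole_param_def)
  next
    case False
    then have "sgn (r *\<^sub>R \<theta>) = \<theta>" "norm (r *\<^sub>R \<theta>) = r"
      using r \<theta> by (auto simp: sgn_scaleR sgn_div_norm split: if_splits)
    moreover have "ereal r < b" using False r by auto
    ultimately show thesis using that(1)[of "r *\<^sub>R \<theta>"]
      by (simp add: p pole_param_def chart_dom_def)
  qed
qed

lemma laplace_beltrami_locally_constant:
  fixes x :: "real^'n::finite"
  assumes "open S" "x \<in> S" "\<And>y. y \<in> S \<Longrightarrow> F y = c"
  shows "laplace_beltrami G F x = 0"
proof -
  have const: "partial i (\<lambda>y. d) x = 0" for i :: 'n and d :: real and x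
    using partial_eq[of "\<lambda>y. d" "\<lambda>v. 0" x i] by simp
  have "partial i F y = 0" if "y \<in> S" for i y
    using partial_cong[OF assms(1) that, of F "\<lambda>_. c"] assms(3) const by simp
  then have "gradient G F y = 0" if "y \<in> S" for y
    using that by (simp add: gradient_def flip: zero_vec_def)
  then have "partial i (\<lambda>y. sqrt (det (G y)) * gradient G F y $ i) x = 0" for i
    using partial_cong[OF assms(1,2), of "\<lambda>y. sqrt (det (G y)) * gradient G F y $ i" "\<lambda>_. 0"] const
    by simp
  then show ?thesis by (simp add: laplace_beltrami_def divergence_def)
qed

text \<open>The antipodal point needs the second chart, so the two kinds of points are treated apart.\<close>

lemma model_laplacian_constant:
  fixes F :: "'n::finite point \<Rightarrow> real"
  assumes "0 < b" "\<And>p. p \<in> model_space b \<Longrightarrow> F p = c" "p \<in> model_space b"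
  shows "model_laplacian f b F p = 0"
  using assms(3)
proof (cases rule: model_space_cases)
  case (1 x)
  then have "model_laplacian f b F p = laplace_beltrami (polar_metric f) (F \<circ> pole_param) x"
    by (simp add: model_laplacian_def pole_param_def norm_scaleR_sgn chart_dom_def)
  also have "\<dots> = 0"
    using 1 by (intro laplace_beltrami_locally_constant[OF open_chart_dom[of b], where c = c])
      (simp_all add: pole_param_mem assms(2))
  finally show ?thesis .
next
  case (2 \<beta>)
  then have "model_laplacian f b F p =
      laplace_beltrami (polar_metric (\<lambda>t. f (real_of_ereal b - t))) (F \<circ> antipole_param b) 0"
    by (simp add: model_laplacian_def antipole_param_def)
  also have "\<dots> = 0"
  proof (rule laplace_beltrami_locally_constant[OF open_chart_dom[of b]])
    show "0 \<in> chart_dom b" using assms(1) by (simp add: chart_dom_def zero_ereal_def)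
    show "(F \<circ> antipole_param b) y = c" if "y \<in> chart_dom b" for y
      using antipole_param_mem[OF 2(1) _ that] assms(1,2) 2(1) by simp
  qed
  finally show ?thesis .
qed

lemma chart_preimage:
  "{x \<in> chart_dom b. pole_param x \<in> model_space b} = chart_dom b"
  "b = ereal \<beta> \<Longrightarrow> 0 < b \<Longrightarrow> {x \<in> chart_dom b. antipole_param b x \<in> model_space b} = chart_dom b"
  using pole_param_mem antipole_param_mem[of b \<beta>] by auto

lemma initial_interval_in_radii:
  assumes "0 < b"
  obtains e where "0 < e" "{0..e} \<subseteq> radii b"
proof -
  obtain e where e: "0 < e" "ereal e < b"
    using assms ereal_dense2[of 0 b] by auto
  then have "{0..e} \<subseteq> radii b"
    by (auto simp: radii_def) (metis ereal_less_eq(3) less_imp_le order_trans)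
  with e(1) show thesis by (rule that)
qed

lemma at_right_le_at_within_radii:
  assumes "0 < b"
  shows "at_right 0 \<le> at 0 within radii b"
proof -
  obtain e where "0 < e" "{0..e} \<subseteq> radii b"
    using initial_interval_in_radii[OF assms] .
  then show ?thesis
    using at_le[of "{0..e}" "radii b" 0] by (simp add: at_within_Icc_at_right)
qed

context
  fixes f :: "real \<Rightarrow> real" and b :: ereal
  assumes model: "model_function f b"
begin

lemma model_function_derivative:
  assumes "r \<in> radii b"
  shows "((deriv_within (radii b) ^^ j) f has_real_derivative (deriv_within (radii b) ^^ Suc j) f r)
    (at r within radii b)"
proof -
  have "(deriv_within (radii b) ^^ j) f differentiable (at r within radii b)"
    using model assms by (auto simp: model_function_def smooth_on_interval_def)
  then show ?thesis
    by (simp add: vector_derivative_works deriv_within_def has_real_derivative_iff_has_vector_derivative)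
qed

lemma radial_profiles_model:
  assumes g: "\<And>j t. ereal \<bar>t\<bar> < b \<Longrightarrow> (g j has_real_derivative g (Suc j) t) (at t)"
    and odd: "\<And>j. odd j \<Longrightarrow> g j 0 = 0"
  shows "radial_profiles (\<lambda>j. (deriv_within (radii b) ^^ j) f) g b"
proof
  show b: "0 < b" using model by (simp add: model_function_def)
  then have 0: "0 \<in> radii b" by (simp add: radii_def zero_ereal_def)
  note lim = tendsto_mono[OF at_right_le_at_within_radii[OF b]]
  show "0 < (deriv_within (radii b) ^^ 0) f r" if "0 < r" "ereal r < b" for r
    using model that by (simp add: model_function_def)
  show "((deriv_within (radii b) ^^ j) f has_real_derivative (deriv_within (radii b) ^^ Suc j) f r) (at r)"
    if "0 < r" "ereal r < b" for j r
  proof -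
    have "open {s. 0 < s \<and> ereal s < b}"
      by (cases b) (auto intro!: open_Collect_conj open_Collect_less continuous_intros)
    then have "at r within radii b = at r"
      by (rule at_within_open_subset[rotated]) (use that in \<open>auto simp: radii_def\<close>)
    then show ?thesis
      using model_function_derivative[of r j] that by (simp add: radii_def)
  qed
  show "((deriv_within (radii b) ^^ j) f \<longlongrightarrow> (deriv_within (radii b) ^^ j) f 0) (at_right 0)" for j
    using lim DERIV_continuous[OF model_function_derivative[OF 0]]
    by (auto simp: continuous_within)
  show "(deriv_within (radii b) ^^ 0) f 0 = 0" "(deriv_within (radii b) ^^ 1) f 0 = 1"
    using model by (simp_all add: model_function_def)
  show "((\<lambda>r. (deriv_within (radii b) ^^ 0) f r / r) \<longlongrightarrow> 1) (at_right 0)"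
    using lim model_function_derivative[OF 0, of 0] model
    by (auto simp: has_field_derivative_iff model_function_def)
qed (use assms in auto)

end

text \<open>
  At the antipodal point the profile of a smooth radial function is even too, so the flux
  \<open>f\<^sup>n g'\<close> vanishes at both ends of \<open>[0, \<beta>]\<close>, and its derivative \<open>c f\<^sup>n\<close> has a zero in between.
\<close>

lemma flux_balance:
  fixes f g h :: "real \<Rightarrow> real"
  assumes \<beta>: "0 < \<beta>" and f: "continuous_on {0..\<beta>} f" "\<And>r. 0 < r \<Longrightarrow> r < \<beta> \<Longrightarrow> 0 < f r"
    and flux: "\<And>r. 0 < r \<Longrightarrow> r < \<beta> \<Longrightarrow> ((\<lambda>r. f r ^ n * g r) has_real_derivative f r ^ n * c) (at r)"
    and g: "\<And>r. 0 \<le> r \<Longrightarrow> r < \<beta> \<Longrightarrow> isCont g r" "g 0 = 0"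
    and h: "\<And>r. 0 \<le> r \<Longrightarrow> r < \<beta> \<Longrightarrow> isCont h r" "h 0 = 0"
    and gh: "\<And>r. 0 < r \<Longrightarrow> r < \<beta> \<Longrightarrow> g r = - h (\<beta> - r)"
  shows "c = 0"
proof -
  define k where "k r = (if r \<le> \<beta> / 2 then g r else - h (\<beta> - r))" for r
  have k: "k r = g r" if "0 < r" "r < \<beta>" for r
    using gh[OF that] by (simp add: k_def)
  have "continuous_on {0..\<beta>} k"
    unfolding k_def
  proof (rule continuous_on_cases_le)
    show "continuous_on {t \<in> {0..\<beta>}. t \<le> \<beta> / 2} g"
      using \<beta> g(1) by (intro continuous_at_imp_continuous_on) auto
    have "isCont (\<lambda>r. - h (\<beta> - r)) t" if "\<beta> / 2 \<le> t" "t \<le> \<beta>" for t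
      using that \<beta> isCont_o2[of t "\<lambda>r. \<beta> - r" h] h(1)[of "\<beta> - t"] by (auto intro!: continuous_intros)
    then show "continuous_on {t \<in> {0..\<beta>}. \<beta> / 2 \<le> t} (\<lambda>r. - h (\<beta> - r))"
      by (intro continuous_at_imp_continuous_on) auto
  qed (use \<beta> gh in \<open>auto intro: continuous_intros\<close>)
  then have "continuous_on {0..\<beta>} (\<lambda>r. f r ^ n * k r)"
    using f(1) by (intro continuous_intros)
  moreover have D: "((\<lambda>r. f r ^ n * k r) has_real_derivative f r ^ n * c) (at r)" if "0 < r" "r < \<beta>" for r
    by (rule has_field_derivative_transform_within_open[OF flux[OF that], of "{0<..<\<beta>}"])
      (use that k in auto)
  moreover have "k 0 = 0" "k \<beta> = 0"
    using \<beta> g(2) h(2) by (simp_all add: k_def)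
  moreover have "(\<lambda>r. f r ^ n * k r) differentiable (at r)" if "0 < r" "r < \<beta>" for r
    using D[OF that] real_differentiable_def by blast
  ultimately have "\<exists>z>0. z < \<beta> \<and> ((\<lambda>r. f r ^ n * k r) has_real_derivative 0) (at z)"
    by (intro Rolle \<beta>) simp_all
  then obtain z where z: "0 < z" "z < \<beta>" "((\<lambda>r. f r ^ n * k r) has_real_derivative 0) (at z)"
    by blast
  then show "c = 0"
    using DERIV_unique[OF D z(3)] f(2)[of z] by auto
qed

text \<open>
  The radial harmonic function off the pole with flux \<open>1\<close>, singular at the pole like the fundamental
  solution of the Laplacian.  Its smoothness comes from that of \<open>fd 0\<close>, with derivatives \<open>fd j\<close>.
\<close>

lemma radial_harmonic_function:
  fixes fd :: "nat \<Rightarrow> real \<Rightarrow> real"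
  assumes fd: "\<And>j r. 0 < r \<Longrightarrow> (fd j has_real_derivative fd (Suc j) r) (at r)"
    and pos: "\<And>r. 0 < r \<Longrightarrow> 0 < fd 0 r"
  obtains \<Psi> where "\<And>r. 0 < r \<Longrightarrow> (\<Psi> has_real_derivative 1 / fd 0 r ^ n) (at r)"
    and "smooth_on (- {0}) (\<lambda>x::real^'n::finite. \<Psi> (norm x))"
proof -
  have "isCont (\<lambda>r. 1 / fd 0 r ^ n) r" if "0 < r" for r
    using DERIV_isCont[OF fd[OF that]] pos[OF that] by (intro continuous_intros) auto
  then obtain \<Psi> where \<Psi>: "(\<Psi> has_real_derivative 1 / fd 0 r ^ n) (at r)" if "0 < r" for r
    using einterval_antiderivative[of 0 "\<infinity>" "\<lambda>r. 1 / fd 0 r ^ n"]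
    by (auto simp: has_real_derivative_iff_has_vector_derivative zero_ereal_def)
  have S: "open (- {0::real^'n})" "0 \<notin> - {0::real^'n}" by auto
  have fd_Ck: "Ck_on k (- {0::real^'n}) (\<lambda>x. fd j (norm x))" for k j
  proof (induction k arbitrary: j)
    case 0
    have "isCont (\<lambda>x. fd j (norm x)) x" if "x \<noteq> 0" for x :: "real^'n"
      using DERIV_isCont[OF fd[of "norm x" j]] that isCont_o2[of x norm "fd j"] by (auto intro: continuous_intros)
    then show ?case by (auto intro: continuous_at_imp_continuous_on)
  next
    case (Suc k)
    show ?case by (rule Ck_on_radialI[OF S, where \<phi>' = "fd (Suc j)"]) (auto intro: fd Suc Ck_on_norm)
  qed
  have "Ck_on k (- {0::real^'n}) (\<lambda>x. \<Psi> (norm x))" for k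
  proof (rule Ck_on_Suc_imp, rule Ck_on_radialI[OF S, where \<phi>' = "\<lambda>r. 1 / fd 0 r ^ n"])
    have "fd 0 (norm x) ^ n \<noteq> 0" if "x \<in> - {0}" for x :: "real^'n"
      using pos[of "norm x"] that by simp
    then have "Ck_on k (- {0::real^'n}) (\<lambda>x. inverse (fd 0 (norm x) ^ n))"
      by (intro Ck_on_inverse Ck_on_power fd_Ck) auto
    then show "Ck_on k (- {0::real^'n}) (\<lambda>x. 1 / fd 0 (norm x) ^ n)"
      by (simp add: inverse_eq_divide)
  qed (auto intro: \<Psi> Ck_on_norm)
  then show thesis using that \<Psi> by (auto simp: smooth_on_def)
qed

section \<open>Rigidity\<close>

lemma smooth_on_constant: "smooth_on (S :: (real^'n::finite) set) (\<lambda>x. c)"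
  by (simp add: smooth_on_def Ck_on_const)

lemma proper_harmonic_one:
  assumes "0 < b"
  shows "proper_s_harmonic f b 1 (model_space b) (\<lambda>p::'n::finite point. 1)"
proof -
  have "(0, 0) \<in> (model_space b :: 'n point set)"
    using assms by (auto simp: model_space_def radii_def zero_ereal_def less_imp_le)
  then show ?thesis
    using model_laplacian_constant[OF assms, of "\<lambda>_. 1" 1 _ f]
    by (auto simp: proper_s_harmonic_def s_harmonic_def model_smooth_def comp_def smooth_on_constant)
qed

text \<open>
  The normal coordinates at the antipodal point provide a second even profile of a smooth radial
  function, which is the first one read from the other end of \<open>[0, \<beta>]\<close>.
\<close>

lemma antipodal_profile:
  fixes H :: "'n::finite point \<Rightarrow> real"
  assumes \<beta>: "b = ereal \<beta>" "0 < \<beta>"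
    and smooth: "model_smooth b (model_space b) H" and radial: "radial b H"
    and Hg: "\<And>x. x \<in> chart_dom b \<Longrightarrow> H (pole_param x) = \<phi> (norm x)"
  obtains h :: "nat \<Rightarrow> real \<Rightarrow> real"
  where "\<And>j t. \<bar>t\<bar> < \<beta> \<Longrightarrow> (h j has_real_derivative h (Suc j) t) (at t)"
    and "h 1 0 = 0" and "H (antipole_param b 0) = h 0 0"
    and "\<And>r. 0 < r \<Longrightarrow> r < \<beta> \<Longrightarrow> \<phi> r = h 0 (\<beta> - r)"
proof -
  have b: "0 < b" using \<beta> by simp
  note mem = antipole_param_mem[OF \<beta>]
  have H_eq: "H p = H q" if "p \<in> model_space b" "q \<in> model_space b" "snd p = snd q" for p q
    using radial that by (auto simp: radial_def)
  have "smooth_on (chart_dom b) (H \<circ> antipole_param b)"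
    using smooth \<beta>(1) unfolding model_smooth_def chart_preimage(2)[OF \<beta>(1) b] by auto
  moreover have "(H \<circ> antipole_param b) x = (H \<circ> antipole_param b) y"
    if "x \<in> chart_dom b" "norm x = norm y" for x y :: "real^'n"
    using that H_eq[OF mem[of x] mem[of y]]
    by (simp add: chart_dom_def) (simp add: antipole_param_def)
  ultimately obtain h where
    h: "\<And>j t. ereal \<bar>t\<bar> < b \<Longrightarrow> (h j has_real_derivative h (Suc j) t) (at t)"
    and Hh: "\<And>x. x \<in> chart_dom b \<Longrightarrow> (H \<circ> antipole_param b) x = h 0 (norm x)"
    and h_odd: "\<And>j. 0 < b \<Longrightarrow> odd j \<Longrightarrow> h j 0 = 0"
    using radial_profile[of b "H \<circ> antipole_param b"] by metis
  fix i :: 'n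
  have "\<phi> r = h 0 (\<beta> - r)" if r: "0 < r" "r < \<beta>" for r
  proof -
    let ?x = "(\<beta> - r) *\<^sub>R axis i 1 :: real^'n" and ?y = "r *\<^sub>R axis i 1 :: real^'n"
    have dom: "?x \<in> chart_dom b" "?y \<in> chart_dom b" "?x \<noteq> 0"
      using r \<beta> by (auto simp: chart_dom_def)
    have "H (antipole_param b ?x) = H (pole_param ?y)"
      by (rule H_eq[OF mem[OF dom(1)] pole_param_mem[OF dom(2)]])
        (use r \<beta> in \<open>simp add: antipole_param_def pole_param_def\<close>)
    then show ?thesis using Hg[OF dom(2)] Hh[OF dom(1)] r by simp
  qed
  moreover have "H (antipole_param b 0) = h 0 0"
    using Hh[of 0] b by (simp add: chart_dom_def zero_ereal_def)
  ultimately show thesis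
    using h h_odd[OF b, of 1] \<beta>(1) by (intro that[of h]) simp_all
qed

theorem theorem1p7:
  fixes f :: "real \<Rightarrow> real" and b :: ereal and H :: "'n::finite point \<Rightarrow> real"
  assumes "model_function f b"
    and "weak_almansi f b H"
  shows "euclidean_model TYPE('n) f b \<and>
    (CARD('n) \<ge> 2 \<longrightarrow> (\<forall>r\<ge>0. f r = r)) \<and>
    (\<exists>c1 c2. c1 \<noteq> 0 \<and>
       (\<forall>x::real^'n. H (pole_param x) = c1 * (\<Sum>j\<in>UNIV. (x $ j)\<^sup>2) + c2))"
proof -
  have b: "0 < b" using assms(1) by (simp add: model_function_def)
  have smooth: "model_smooth b (model_space b) H" and radial: "radial b H"
    and local: "\<And>U F. model_open b U \<Longrightarrow> s_harmonic f b 1 U F \<Longrightarrow> s_harmonic f b 2 U (\<lambda>p. H p * F p)"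
    and global: "\<And>F. proper_s_harmonic f b 1 (model_space b) F \<Longrightarrow>
        proper_s_harmonic f b 2 (model_space b) (\<lambda>p. H p * F p)"
    using assms(2) by (auto simp: weak_almansi_def)
  have H_eq: "H p = H q" if "p \<in> model_space b" "q \<in> model_space b" "snd p = snd q" for p q
    using radial that by (auto simp: radial_def)
  have "smooth_on (chart_dom b) (H \<circ> pole_param)"
    using smooth unfolding model_smooth_def chart_preimage(1) by blast
  moreover have "(H \<circ> pole_param) x = (H \<circ> pole_param) y"
    if "x \<in> chart_dom b" "norm x = norm y" for x y :: "real^'n"
    using that H_eq[OF pole_param_mem[of x b] pole_param_mem[of y b]]
    by (simp add: chart_dom_def) (simp add: pole_param_def)
  ultimately obtain g where
    g: "\<And>j t. ereal \<bar>t\<bar> < b \<Longrightarrow> (g j has_real_derivative g (Suc j) t) (at t)"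
    and Hg: "\<And>x. x \<in> chart_dom b \<Longrightarrow> (H \<circ> pole_param) x = g 0 (norm x)"
    and odd_g: "\<And>j. 0 < b \<Longrightarrow> odd j \<Longrightarrow> g j 0 = 0"
    using radial_profile[of b "H \<circ> pole_param"] by metis
  define fd where "fd j = (deriv_within (radii b) ^^ j) f" for j
  define n where "n = CARD('n) - 1"
  have fd0: "fd 0 = f" by (simp add: fd_def)
  interpret radial_profiles fd g b n
    unfolding fd_def[abs_def]
    by (rule radial_profiles_model[OF assms(1)]) (use g odd_g[OF b] in auto)
  have w: "w r = f r ^ (CARD('n) - 1)" for r
    unfolding w_def unfolding fd0 n_def ..
  have laplacian: "model_laplacian f b F (pole_param x) = q / w (norm x)"
    if "\<And>y. y \<noteq> 0 \<Longrightarrow> ereal (norm y) < b \<Longrightarrow> F (pole_param y) = \<phi> (norm y)"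
      "\<And>r. 0 < r \<Longrightarrow> ereal r < b \<Longrightarrow> (\<phi> has_real_derivative \<phi>' r) (at r)"
      "((\<lambda>r. w r * \<phi>' r) has_real_derivative q) (at (norm x))"
      "x \<noteq> 0" "ereal (norm x) < b" for F :: "'n point \<Rightarrow> real" and \<phi> \<phi>' q x
    unfolding w
    by (rule radial_model_laplacian[where \<phi> = \<phi> and \<phi>' = \<phi>'])
      (use that f_pos in \<open>simp_all add: fd0 w\<close>)
  \<comment> \<open>The axis \<open>i\<close> serves to place a point at a given distance from the pole.\<close>
  fix i :: 'n
  have lap_H: "model_laplacian f b H (pole_param x) = lap (norm x)" if "x \<noteq> 0" "ereal (norm x) < b" for x
  proof -
    have "model_laplacian f b H (pole_param x) = w (norm x) * lap (norm x) / w (norm x)"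
      by (rule laplacian[of H "g 0" "g 1"])
        (use that Hg g[of _ 0] flux_deriv in \<open>auto simp: chart_dom_def\<close>)
    then show ?thesis using w_pos[of "norm x"] that by simp
  qed
  have biharmonic_H: "s_harmonic f b 2 (model_space b) H"
    and proper_H: "\<exists>p\<in>model_space b. model_laplacian f b H p \<noteq> 0"
    using global[OF proper_harmonic_one[OF b]] by (auto simp: proper_s_harmonic_def)
  \<comment> \<open>Biharmonicity of \<open>H\<close>, tested along a ray, is the differential equation of \<open>lap_constant\<close>.\<close>
  have lap_const: "lap r = (n + 1) * g 2 0" if "0 < r" "ereal r < b" for r
  proof (rule lap_constant[OF _ that])
    fix r d assume r: "0 < r" "ereal r < b" and d: "((\<lambda>r. w r * lap' r) has_real_derivative d) (at r)"
    let ?x = "r *\<^sub>R axis i 1 :: real^'n"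
    have "model_laplacian f b (model_laplacian f b H) (pole_param ?x) = d / w (norm ?x)"
      by (rule laplacian[of _ lap lap']) (use lap_H lap_deriv d r in auto)
    moreover have "pole_param ?x \<in> model_space b"
      by (rule pole_param_mem) (use r in \<open>simp add: chart_dom_def\<close>)
    ultimately show "d = 0"
      using biharmonic_H w_pos[OF r] r by (auto simp: s_harmonic_def numeral_2_eq_2)
  qed
  have H_pole: "H (pole_param x) = g 0 (norm x)" if "x \<in> chart_dom b" for x
    using Hg[OF that] by simp
  \<comment> \<open>If that constant were zero, \<open>H\<close> would be constant, also at the antipodal point by continuity,
    and would not be proper biharmonic.\<close>
  have a: "g 2 0 \<noteq> 0"
  proof
    assume a: "g 2 0 = 0"
    have const: "g 0 r = g 0 0" if "0 \<le> r" "ereal r < b" for r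
      using lap_zero_imp_constant[of r] lap_const that by (cases "r = 0") (auto simp: a)
    have "H p = g 0 0" if "p \<in> model_space b" for p
      using that
    proof (cases rule: model_space_cases)
      case (1 x)
      then show ?thesis using Hg[of x] const[of "norm x"] by (simp add: chart_dom_def)
    next
      case (2 \<beta>)
      then have \<beta>: "0 < \<beta>" using b by simp
      obtain h :: "nat \<Rightarrow> real \<Rightarrow> real"
        where h: "\<And>j t. \<bar>t\<bar> < \<beta> \<Longrightarrow> (h j has_real_derivative h (Suc j) t) (at t)" "h 1 0 = 0"
        and Hh: "H (antipole_param b 0) = h 0 0"
        and gh: "\<And>r. 0 < r \<Longrightarrow> r < \<beta> \<Longrightarrow> g 0 r = h 0 (\<beta> - r)"
        by (rule antipodal_profile[OF 2(1) \<beta> smooth radial], erule H_pole) (rule that; simp)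
      have "(h 0 \<longlongrightarrow> h 0 0) (at_right 0)"
        using DERIV_isCont[OF h(1)[of 0 0]] \<beta>
        by (auto simp: isCont_def intro: filterlim_mono[OF _ order_refl at_le])
      moreover have "h 0 r = g 0 0" if "0 < r" "r < \<beta>" for r
        using gh[of "\<beta> - r"] const[of "\<beta> - r"] that 2(1) by simp
      then have "eventually (\<lambda>r. h 0 r = g 0 0) (at_right 0)"
        unfolding eventually_at_right_field using \<beta> by blast
      ultimately have "((\<lambda>r. g 0 0) \<longlongrightarrow> h 0 0) (at_right (0::real))"
        by (rule Lim_transform_eventually)
      then have "g 0 0 = h 0 0"
        using tendsto_unique[OF trivial_limit_at_right_real tendsto_const] by blast
      then show ?thesis using Hh 2 by simp
    qed
    then show False
      using proper_H model_laplacian_constant[OF b, of H] by metis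
  qed
  have "b = \<infinity>"
  proof (cases b)
    case (real \<beta>)
    then have \<beta>: "0 < \<beta>" using b by simp
    have radii: "radii b = {0..\<beta>}" by (auto simp: radii_def real)
    obtain h :: "nat \<Rightarrow> real \<Rightarrow> real"
      where h: "\<And>j t. \<bar>t\<bar> < \<beta> \<Longrightarrow> (h j has_real_derivative h (Suc j) t) (at t)" "h 1 0 = 0"
        and "H (antipole_param b 0) = h 0 0"
        and gh: "\<And>r. 0 < r \<Longrightarrow> r < \<beta> \<Longrightarrow> g 0 r = h 0 (\<beta> - r)"
      by (rule antipodal_profile[OF real \<beta> smooth radial], erule H_pole) (rule that; simp)
    have gh1: "g 1 r = - h 1 (\<beta> - r)" if "0 < r" "r < \<beta>" for r
    proof (rule DERIV_unique)
      show "(g 0 has_real_derivative g 1 r) (at r)" using g[of r 0] that real by simp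
      have "((\<lambda>r. h 0 (\<beta> - r)) has_real_derivative h 1 (\<beta> - r) * (0 - 1)) (at r)"
        by (rule DERIV_chain2[OF _ DERIV_diff[OF DERIV_const DERIV_ident]])
          (use h(1)[of "\<beta> - r" 0] that in simp)
      then show "(g 0 has_real_derivative - h 1 (\<beta> - r)) (at r)"
        using has_field_derivative_transform_within_open[of "\<lambda>r. h 0 (\<beta> - r)" _ r "{0<..<\<beta>}" "g 0"] that gh
        by simp
    qed
    have "(n + 1) * g 2 0 = 0"
    proof (rule flux_balance[OF \<beta>, of f n "g 1" _ "h 1"])
      show "continuous_on {0..\<beta>} f"
        using DERIV_continuous[OF model_function_derivative[OF assms(1), of _ 0]]
        by (simp add: continuous_on_eq_continuous_within radii)
      show "((\<lambda>r. f r ^ n * g 1 r) has_real_derivative f r ^ n * ((n + 1) * g 2 0)) (at r)"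
        if "0 < r" "r < \<beta>" for r
        using flux_deriv[of r] lap_const[of r] that real by (simp add: w_def[abs_def] fd0)
      show "isCont (g 1) r" "isCont (h 1) r" if "0 \<le> r" "r < \<beta>" for r
        using DERIV_isCont[OF g[of r 1]] DERIV_isCont[OF h(1)[of r 1]] that real by auto
    qed (use f_pos real h(2) gh1 g_odd[of 1] in \<open>auto simp: fd0\<close>)
    then show ?thesis using a by simp
  qed (use b in auto)
  note [simp] = \<open>b = \<infinity>\<close>
  \<comment> \<open>The local part of the property, applied to the model without its pole and the harmonic function
    that is singular there.\<close>
  obtain \<Psi> where \<Psi>: "\<And>r. 0 < r \<Longrightarrow> (\<Psi> has_real_derivative 1 / w r) (at r)"
    and \<Psi>_smooth: "smooth_on (- {0}) (\<lambda>x::real^'n. \<Psi> (norm x))"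
    using radial_harmonic_function[of fd n] f_deriv f_pos unfolding w_def by auto
  define F :: "'n point \<Rightarrow> real" where "F p = \<Psi> (snd p)" for p
  define U :: "'n point set" where "U = {p \<in> model_space b. snd p > 0}"
  have F_pole: "F (pole_param y) = \<Psi> (norm y)" for y
    by (simp add: F_def pole_param_def)
  have dom: "chart_dom \<infinity> = (UNIV :: (real^'n) set)"
    by (simp add: chart_dom_def)
  have U_pole: "{x \<in> chart_dom b. pole_param x \<in> U} = - {0}"
    using pole_param_mem[of _ b, where 'n = 'n] by (auto simp: U_def pole_param_def dom)
  have U_cases: "\<exists>x. x \<noteq> 0 \<and> p = pole_param x" if "p \<in> U" for p
    using that unfolding U_def
    by (auto elim!: model_space_cases simp: pole_param_def)
  have "model_open b U"
    unfolding model_open_def U_pole by (auto simp: U_def)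
  moreover have "s_harmonic f b 1 U F"
  proof -
    have "model_laplacian f b F (pole_param x) = 0 / w (norm x)" if "x \<noteq> 0" for x
    proof (rule laplacian[of F \<Psi> "\<lambda>r. 1 / w r"])
      show "((\<lambda>r. w r * (1 / w r)) has_real_derivative 0) (at (norm x))"
        by (rule has_field_derivative_transform_within_open[OF DERIV_const[of 1], of "{0<..}"])
          (use that w_pos in \<open>auto simp: less_imp_neq[symmetric]\<close>)
    qed (use that \<Psi> F_pole in auto)
    then have "model_laplacian f b F p = 0" if "p \<in> U" for p
      using U_cases[OF that] by auto
    moreover have "F \<circ> pole_param = (\<lambda>x. \<Psi> (norm x))"
      by (simp add: fun_eq_iff F_pole)
    ultimately show ?thesis
      using \<Psi>_smooth by (auto simp: s_harmonic_def model_smooth_def U_pole[simplified])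
  qed
  ultimately have biharmonic: "s_harmonic f b 2 U (\<lambda>p. H p * F p)"
    by (rule local)
  \<comment> \<open>The two Laplacians of the product are the ones computed for profiles above.\<close>
  have g3: "g 3 r = 0" if r: "0 < r" for r
  proof -
    define c where "c = (n + 1) * g 2 0"
    have lap_c: "\<And>r. 0 < r \<Longrightarrow> ereal r < b \<Longrightarrow> lap r = c"
      using lap_const by (simp add: c_def)
    have \<Psi>': "\<And>r. 0 < r \<Longrightarrow> ereal r < b \<Longrightarrow> (\<Psi> has_real_derivative 1 / w r) (at r)"
      using \<Psi> by blast
    have product:
      "((\<lambda>r. g 0 r * \<Psi> r) has_real_derivative (w s * g 1 s * \<Psi> s + g 0 s) / w s) (at s)"
      "((\<lambda>r. w r * g 1 r * \<Psi> r + g 0 r) has_real_derivative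
        (c * \<Psi> s + 2 * (g 1 s * (1 / w s))) * w s) (at s)"
      "((\<lambda>r. c * \<Psi> r + 2 * (g 1 r * (1 / w r))) has_real_derivative (4 * g 2 s - c) / w s) (at s)"
      if "0 < s" for s
      by (rule product_deriv product_flux_deriv product_lap_deriv; use \<Psi>' lap_c that in simp)+
    let ?x = "r *\<^sub>R axis i 1 :: real^'n"
    have w_nz: "w s \<noteq> 0" if "0 < s" for s using w_pos[of s] that by simp
    have first: "model_laplacian f b (\<lambda>p. H p * F p) (pole_param x)
        = c * \<Psi> (norm x) + 2 * (g 1 (norm x) * (1 / w (norm x)))" if "x \<noteq> 0" for x
    proof -
      have "model_laplacian f b (\<lambda>p. H p * F p) (pole_param x)
          = (c * \<Psi> (norm x) + 2 * (g 1 (norm x) * (1 / w (norm x)))) * w (norm x) / w (norm x)"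
      proof (rule laplacian[where \<phi> = "\<lambda>r. g 0 r * \<Psi> r"])
        show "((\<lambda>r. w r * ((w r * g 1 r * \<Psi> r + g 0 r) / w r)) has_real_derivative
            (c * \<Psi> (norm x) + 2 * (g 1 (norm x) * (1 / w (norm x)))) * w (norm x)) (at (norm x))"
          by (rule has_field_derivative_transform_within_open[OF product(2), of _ "{0<..}"])
            (use that w_nz in auto)
        show "((\<lambda>r. g 0 r * \<Psi> r) has_real_derivative (w s * g 1 s * \<Psi> s + g 0 s) / w s) (at s)"
          if "0 < s" "ereal s < b" for s by (rule product(1)[OF that(1)])
      qed (use that Hg in \<open>simp_all add: F_pole dom\<close>)
      then show ?thesis using w_nz[of "norm x"] that by simp
    qed
    have "model_laplacian f b (model_laplacian f b (\<lambda>p. H p * F p)) (pole_param ?x) = (4 * g 3 r) / w (norm ?x)"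
    proof (rule laplacian[where \<phi> = "\<lambda>r. c * \<Psi> r + 2 * (g 1 r * (1 / w r))"])
      have "((\<lambda>r. 4 * g 2 r - c) has_real_derivative 4 * g 3 r) (at r)"
        using DERIV_diff[OF DERIV_cmult[OF g[of r 2]] DERIV_const] r by (simp add: numeral_3_eq_3 numeral_2_eq_2)
      then show "((\<lambda>r. w r * ((4 * g 2 r - c) / w r)) has_real_derivative 4 * g 3 r) (at (norm ?x))"
        using has_field_derivative_transform_within_open[of "\<lambda>r. 4 * g 2 r - c" _ r "{0<..}"] r w_nz
        by simp
      show "model_laplacian f b (\<lambda>p. H p * F p) (pole_param y) = c * \<Psi> (norm y) + 2 * (g 1 (norm y) * (1 / w (norm y)))"
        if "y \<noteq> 0" for y by (rule first[OF that])
      show "((\<lambda>r. c * \<Psi> r + 2 * (g 1 r * (1 / w r))) has_real_derivative (4 * g 2 s - c) / w s) (at s)"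
        if "0 < s" "ereal s < b" for s by (rule product(3)[OF that(1)])
    qed (use r in simp_all)
    moreover have "?x \<in> {x \<in> chart_dom b. pole_param x \<in> U}"
      unfolding U_pole using r by simp
    then have "(model_laplacian f b ^^ 2) (\<lambda>p. H p * F p) (pole_param ?x) = 0"
      using biharmonic unfolding s_harmonic_def by blast
    ultimately have "4 * g 3 r / w r = 0"
      using r by (simp only: numeral_2_eq_2 funpow.simps comp_apply id_apply norm_scaleR norm_axis_1) simp
    then show "g 3 r = 0" using w_nz[OF r] by simp
  qed
  have flat: "f r = r" if "0 < r" "CARD('n) \<ge> 2" for r
    using third_derivative_zero(2)[OF g3 lap_const] that a by (simp add: fd0 n_def)
  have "euclidean_model TYPE('n) f b"
    unfolding euclidean_model_def using flat by (auto intro!: polar_metric_euclidean)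
  moreover have "f 0 = 0" using assms(1) by (simp add: model_function_def)
  moreover have "H (pole_param x) = g 2 0 / 2 * (\<Sum>j\<in>UNIV. (x $ j)\<^sup>2) + g 0 0" for x
  proof -
    have "(norm x)\<^sup>2 = (\<Sum>j\<in>UNIV. (x $ j)\<^sup>2)"
      unfolding power2_norm_eq_inner inner_vec_def by (simp add: power2_eq_square)
    moreover have "g 0 (norm x) = g 2 0 / 2 * (norm x)\<^sup>2 + g 0 0"
      using third_derivative_zero(1)[OF g3 lap_const, of "norm x"] by (cases "x = 0") auto
    ultimately show ?thesis using Hg[of x] by (simp add: dom)
  qed
  ultimately show ?thesis
    using flat a by (intro conjI exI[of _ "g 2 0 / 2"] exI[of _ "g 0 0"]) (auto simp: le_less)
qed

end
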